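(* Let $(\mathbb{U},d)$ be a space with distance function $d$, let $r>0$ and $c>1$, and let $\mathcal{H}$ be an $(r,cr,p_1,p_2)$-LSH family with $p_1,p_2=\Omega(1)$ and $\rho=\log p_1/\log p_2$. Let $R,S\subseteq\mathbb{U}$ with $n=|R|+|S|$, and let there be $p<n^{\epsilon}$ processors in the MPC model, for some constant $0<\epsilon<1$, with the input evenly distributed among the processors. Let $\kappa=\lceil (\rho/(1+\rho))\log_{1/p_1} p\rceil$. Assume that for every $x\in R\cup S$ the value $k_x$ (defined in the context) is known. Then the algorithm described in the context runs in $O(1)$ rounds with load $$\tilde O\left(\sqrt{\sum_{i=0}^{\kappa}\frac{\mathrm{OUT}_{r,i}}{p\,p_1^{i}}}+\sqrt{\frac{\mathrm{OUT}_{cr}}{p}}+\frac{n}{p^{1/(1+\rho)}}\right).$$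
   Context: MPC model: $p$ processors connected by a complete network compute in synchronous rounds; in each round each processor performs local computation and sends messages received at the start of the next round. The load is the maximum total size of messages sent/received by any processor in any round; each point of $\mathbb{U}$ occupies $O(1)$ words and $d$ is computable in $O(1)$ time. $\tilde O$ hides polylogarithmic factors. LSH: $\mathcal{H}$ is a family of functions $h:\mathbb{U}\to\mathbb{R}$ such that for random $h\in\mathcal{H}$: if $d(x,y)\le r$ then $\Pr[h(x)=h(y)]\ge p_1$, and if $d(x,y)>cr$ then $\Pr[h(x)=h(y)]\le p_2$ (and in general, $d(q,x)\le d(q,y)$ implies $\Pr[h(q)=h(x)]\ge\Pr[h(q)=h(y)]$). $\mathcal{H}_i$ denotes the family of concatenations $h_i=(h^{(1)},\dots,h^{(i)})$ of $i$ independent functions from $\mathcal{H}$. Similarity join: the goal is to output $R\bowtie_{\le r}S=\{(x,y)\in R\times S: d(x,y)\le r\}$. A pair is near if $d(x,y)\le r$ and $c$-near if $r<d(x,y)\le cr$. For a point $x$, $N_r(x)$ is the number of near points to $x$ in the other set. Definitions of output quantities: for $0\le i<\kappa$, a point $x\in R$ is $i$-dense if $N_r(x)\in[n p_2^{i+1}, n p_2^{i})$, and $\kappa$-dense if $N_r(x)<n p_2^{\kappa}$; analogously for points of $S$. $\mathrm{OUT}_{r,i}$ is the number of near pairs $(x,y)\in R\times S$ containing at least one $i$-dense point; $\mathrm{OUT}_{cr}$ is the number of pairs $(x,y)\in R\times S$ with $r<d(x,y)\le cr$. Level choice: for $x\in R$, $k_x=\arg\min_{i\in[\kappa]} p_1^{-i}\bigl(1+\sum_{y\in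 S}\Pr[h_i(x)=h_i(y)]\bigr)$ with $h_i$ random from $\mathcal{H}_i$; $k_y$ for $y\in S$ is defined symmetrically (summing over $x\in R$). A point $x$ is active in phase $i$ if $i=k_x$, passive if $i<k_x$, dead if $i>k_x$. Algorithm: for each $i\in[\kappa]$ (all phases executed concurrently): (1) choose $t_i=\Theta(p_1^{-i})$ independent random hash functions $h^i_1,\dots,h^i_{t_i}\in\mathcal{H}_i$ and broadcast them; (2) determine for each $x\in R\cup S$ whether it is active, passive, or dead in phase $i$; (3) for each non-dead $x$ and each $j$, generate a tuple with key $(i,j,h^i_j(x))$ and value $x$ together with its status; (4) discard all tuples whose key group contains no active point (via sorting and prefix sums); (5) on the remaining tuples run the optimal output-sensitive MPC equi-join algorithm (which joins two relations of total size $m$ with output size $O$ in $O(1)$ rounds and load $\Theta(\sqrt{O/p}+m/p)$) to generate all pairs $(x,y)\in R\times S$ sharing a key with at least one of $x,y$ active, and output those with $d(x,y)\le r$.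
   Formalization: Adds that pairs at distance more than r collide with probability at most p_1 (p_1 is the collision probability at threshold r) and that p_2 is bounded away from 1 by a constant; without these the load bound fails. Load is bounded in expectation. *)

theory Defs
  imports "HOL-Probability.Probability"
begin

section \<open>Massively parallel computation\<close>

text \<open>
  A protocol for processors \<open>0, \<dots>, p - 1\<close> over words of type \<^typ>\<open>'w\<close>.  Local computation is
  unrestricted and memory is a full history: \<open>send P t q x h\<close> maps every destination to the message
  that processor \<open>q\<close> sends to it in round \<open>t\<close>, given its local input \<open>x\<close> and the list \<open>h\<close> of what
  it received in rounds \<open>0, \<dots>, t - 1\<close> (one function from senders to messages per round).
  \<open>outp P q x h\<close> is its local output after the last round.
\<close>

record ('w, 'i, 'o) protocol =
  rounds :: nat
  send :: "nat \<Rightarrow> nat \<Rightarrow> 'i \<Rightarrow> (nat \<Rightarrow> 'w list) list \<Rightarrow> nat \<Rightarrow> 'w list"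
  outp :: "nat \<Rightarrow> 'i \<Rightarrow> (nat \<Rightarrow> 'w list) list \<Rightarrow> 'o"

primrec history ::
  "('w, 'i, 'o) protocol \<Rightarrow> nat \<Rightarrow> (nat \<Rightarrow> 'i) \<Rightarrow> nat \<Rightarrow> nat \<Rightarrow> (nat \<Rightarrow> 'w list) list" where
  "history P p inp 0 = (\<lambda>q. [])"
| "history P p inp (Suc t) = (\<lambda>q. history P p inp t q @
     [\<lambda>s. if s < p then send P t s (inp s) (history P p inp t s) q else []])"

definition message ::
  "('w, 'i, 'o) protocol \<Rightarrow> nat \<Rightarrow> (nat \<Rightarrow> 'i) \<Rightarrow> nat \<Rightarrow> nat \<Rightarrow> nat \<Rightarrow> 'w list" where
  "message P p inp t s q = send P t s (inp s) (history P p inp t s) q"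

definition result :: "('w, 'i, 'o) protocol \<Rightarrow> nat \<Rightarrow> (nat \<Rightarrow> 'i) \<Rightarrow> nat \<Rightarrow> 'o" where
  "result P p inp q = outp P q (inp q) (history P p inp (rounds P) q)"

definition sent :: "('w, 'i, 'o) protocol \<Rightarrow> nat \<Rightarrow> (nat \<Rightarrow> 'i) \<Rightarrow> nat \<Rightarrow> nat \<Rightarrow> nat" where
  "sent P p inp t q = (\<Sum>q'<p. length (message P p inp t q q'))"

definition received :: "('w, 'i, 'o) protocol \<Rightarrow> nat \<Rightarrow> (nat \<Rightarrow> 'i) \<Rightarrow> nat \<Rightarrow> nat \<Rightarrow> nat" where
  "received P p inp t q = (\<Sum>q'<p. length (message P p inp t q' q))"

definition load :: "('w, 'i, 'o) protocol \<Rightarrow> nat \<Rightarrow> (nat \<Rightarrow> 'i) \<Rightarrow> nat" where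
  "load P p inp =
     Max (insert 0 ((\<lambda>(t, q). max (sent P p inp t q) (received P p inp t q))
                      ` ({..<rounds P} \<times> {..<p})))"

definition seq_comp :: "('w, 'a, 'b) protocol \<Rightarrow> ('w, 'b, 'c) protocol \<Rightarrow> ('w, 'a, 'c) protocol"
    (infixr \<open>>>>\<close> 55) where
  "P >>> Q =
     \<lparr> rounds = rounds P + rounds Q,
       send = (\<lambda>t q x h.
         if t < rounds P then send P t q x h
         else send Q (t - rounds P) q (outp P q x (take (rounds P) h)) (drop (rounds P) h)),
       outp = (\<lambda>q x h. outp Q q (outp P q x (take (rounds P) h)) (drop (rounds P) h)) \<rparr>"

definition local_step :: "('i \<Rightarrow> 'o) \<Rightarrow> ('w, 'i, 'o) protocol" where
  "local_step f = \<lparr> rounds = 0, send = (\<lambda>t q x h q'. []), outp = (\<lambda>q x h. f x) \<rparr>"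

text \<open>Run a protocol while every processor keeps further data in its local memory.\<close>

definition keeping :: "('w, 'i, 'o) protocol \<Rightarrow> ('w, 'i \<times> 'c, 'o \<times> 'c) protocol" where
  "keeping P =
     \<lparr> rounds = rounds P,
       send = (\<lambda>t q x h. send P t q (fst x) h),
       outp = (\<lambda>q x h. (outp P q (fst x) h, snd x)) \<rparr>"

text \<open>
  Broadcast of the input of processor 0 along a tree of fan-out \<open>f\<close> and depth \<open>D\<close>: at the start of
  round \<open>t\<close> exactly the processors below \<open>f ^ t\<close> know the words, and in that round a processor
  \<open>q\<close> with \<open>f ^ t \<le> q < f ^ Suc t\<close> gets them from \<open>q mod f ^ t\<close>.  Every processor is reached when
  \<open>p \<le> f ^ D\<close>.
\<close>

definition broadcast_known :: "nat \<Rightarrow> nat \<Rightarrow> 'w list \<Rightarrow> (nat \<Rightarrow> 'w list) list \<Rightarrow> 'w list" where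
  "broadcast_known p q x h =
     (if q = 0 then x else concat (map (\<lambda>m. concat (map m [0..<p])) h))"

definition broadcast :: "nat \<Rightarrow> nat \<Rightarrow> nat \<Rightarrow> ('w, 'w list, 'w list) protocol" where
  "broadcast p f D =
     \<lparr> rounds = D,
       send = (\<lambda>t q x h q'.
         if f ^ t \<le> q' \<and> q' < f ^ Suc t \<and> q' mod f ^ t = q then broadcast_known p q x h else []),
       outp = broadcast_known p \<rparr>"


section \<open>Guarantees of the standard primitives\<close>

text \<open>
  A primitive is a family of protocols indexed by the number \<open>p\<close> of processors.  The standing
  condition that the total input \<open>p * L\<close> is at least \<open>p\<close> to the power \<open>1 + \<delta>\<close> reads
  \<open>p powr \<delta> \<le> L\<close>, where \<open>L\<close> is the number of items a processor may hold initially, so \<open>L\<close> plays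
  the role of \<open>m / p\<close>.  Loads are counted in words, \<open>W\<close> bounds the number of words of an item, and
  all constants depend on \<open>\<delta>\<close> only.
\<close>

definition gather :: "nat \<Rightarrow> (nat \<Rightarrow> 'b list) \<Rightarrow> 'b list" where
  "gather p xs = concat (map xs [0..<p])"

definition sorting_primitive ::
  "('b \<Rightarrow> nat) \<Rightarrow> ('b \<Rightarrow> 'b \<Rightarrow> bool) \<Rightarrow> real \<Rightarrow> (nat \<Rightarrow> ('w, 'b list, 'b list) protocol) \<Rightarrow> bool" where
  "sorting_primitive sz le \<delta> srt \<longleftrightarrow>
     (\<exists>(K::nat) (C::real). \<forall>p\<ge>1. rounds (srt p) \<le> K \<and>
       (\<forall>inp (L::nat) (W::nat).
          real p powr \<delta> \<le> real L \<and> 1 \<le> W \<and>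
          (\<forall>q<p. length (inp q) \<le> L \<and> (\<forall>a\<in>set (inp q). sz a \<le> W)) \<longrightarrow>
          mset (gather p (result (srt p) p inp)) = mset (gather p inp) \<and>
          sorted_wrt le (gather p (result (srt p) p inp)) \<and>
          (\<forall>q<p. real (length (result (srt p) p inp q)) \<le> C * real L) \<and>
          real (load (srt p) p inp) \<le> C * real W * real L))"

definition prefixes :: "('b \<Rightarrow> 'b \<Rightarrow> 'b) \<Rightarrow> 'b list \<Rightarrow> 'b list" where
  "prefixes f xs = map (\<lambda>i. foldl f (xs ! 0) (take i (tl xs))) [0..<length xs]"

text \<open>
  The operator has to be associative on a set \<open>A\<close> that contains the inputs and is closed under it,
  so that \<open>W\<close> also bounds the size of the partial results.
\<close>

definition prefix_sums_primitive ::
  "('b \<Rightarrow> nat) \<Rightarrow> real \<Rightarrow> (('b \<Rightarrow> 'b \<Rightarrow> 'b) \<Rightarrow> nat \<Rightarrow> ('w, 'b list, 'b list) protocol) \<Rightarrow> bool" where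
  "prefix_sums_primitive sz \<delta> scan \<longleftrightarrow>
     (\<exists>(K::nat) (C::real). \<forall>f. \<forall>p\<ge>1. rounds (scan f p) \<le> K \<and>
       (\<forall>inp A (L::nat) (W::nat).
          real p powr \<delta> \<le> real L \<and> 1 \<le> W \<and>
          (\<forall>a\<in>A. \<forall>b\<in>A. f a b \<in> A) \<and>
          (\<forall>a\<in>A. \<forall>b\<in>A. \<forall>c\<in>A. f (f a b) c = f a (f b c)) \<and>
          (\<forall>a\<in>A. sz a \<le> W) \<and>
          (\<forall>q<p. length (inp q) \<le> L \<and> set (inp q) \<subseteq> A) \<longrightarrow>
          gather p (result (scan f p) p inp) = prefixes f (gather p inp) \<and>
          (\<forall>q<p. length (result (scan f p) p inp q) = length (inp q)) \<and>
          real (load (scan f p) p inp) \<le> C * real W * real L))"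

definition equi_join :: "('b \<Rightarrow> 'k) \<Rightarrow> 'b list \<Rightarrow> 'b list \<Rightarrow> ('b \<times> 'b) list" where
  "equi_join key xs ys = [(a, b). a \<leftarrow> xs, b \<leftarrow> ys, key a = key b]"

definition equi_join_primitive ::
  "('b \<Rightarrow> nat) \<Rightarrow> ('b \<Rightarrow> 'k) \<Rightarrow> real \<Rightarrow>
     (nat \<Rightarrow> ('w, 'b list \<times> 'b list, ('b \<times> 'b) list) protocol) \<Rightarrow> bool" where
  "equi_join_primitive sz key \<delta> ejoin \<longleftrightarrow>
     (\<exists>(K::nat) (C::real). \<forall>p\<ge>1. rounds (ejoin p) \<le> K \<and>
       (\<forall>inp (L::nat) (W::nat).
          real p powr \<delta> \<le> real L \<and> 1 \<le> W \<and>
          (\<forall>q<p. length (fst (inp q)) + length (snd (inp q)) \<le> L \<and>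
                 (\<forall>a\<in>set (fst (inp q)) \<union> set (snd (inp q)). sz a \<le> W)) \<longrightarrow>
          (let J = equi_join key (gather p (fst \<circ> inp)) (gather p (snd \<circ> inp))
           in mset (gather p (result (ejoin p) p inp)) = mset J \<and>
              real (load (ejoin p) p inp) \<le>
                C * real W * (sqrt (real (length J) / real p) + real L))))"


section \<open>Locality-sensitive hashing\<close>

definition distance_function :: "'u set \<Rightarrow> ('u \<Rightarrow> 'u \<Rightarrow> real) \<Rightarrow> bool" where
  "distance_function U d \<longleftrightarrow>
     (\<forall>x\<in>U. d x x = 0) \<and> (\<forall>x\<in>U. \<forall>y\<in>U. 0 \<le> d x y \<and> d x y = d y x)"

definition coll :: "('u \<Rightarrow> real) measure \<Rightarrow> 'u \<Rightarrow> 'u \<Rightarrow> real" where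
  "coll H x y = measure H {h \<in> space H. h x = h y}"

definition lsh_family ::
  "'u set \<Rightarrow> ('u \<Rightarrow> 'u \<Rightarrow> real) \<Rightarrow> real \<Rightarrow> real \<Rightarrow> real \<Rightarrow> real \<Rightarrow> ('u \<Rightarrow> real) measure \<Rightarrow> bool" where
  "lsh_family U d r r' p1 p2 H \<longleftrightarrow>
     prob_space H \<and>
     (\<forall>x\<in>U. (\<lambda>h. h x) \<in> borel_measurable H) \<and>
     (\<forall>x\<in>U. \<forall>y\<in>U. d x y \<le> r \<longrightarrow> p1 \<le> coll H x y) \<and>
     (\<forall>x\<in>U. \<forall>y\<in>U. r' < d x y \<longrightarrow> coll H x y \<le> p2) \<and>
     (\<forall>q\<in>U. \<forall>x\<in>U. \<forall>y\<in>U. d q x \<le> d q y \<longrightarrow> coll H q y \<le> coll H q x)"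

text \<open>
  The convention that \<open>p1\<close> is the collision probability at the threshold \<open>r\<close> itself, and not just
  some smaller lower bound for it: by monotonicity pairs that are not near collide with probability
  at most \<open>p1\<close>.  The definition of an LSH family alone does not give this.
\<close>

definition threshold_prob ::
  "'u set \<Rightarrow> ('u \<Rightarrow> 'u \<Rightarrow> real) \<Rightarrow> real \<Rightarrow> real \<Rightarrow> ('u \<Rightarrow> real) measure \<Rightarrow> bool" where
  "threshold_prob U d r p1 H \<longleftrightarrow> (\<forall>x\<in>U. \<forall>y\<in>U. r < d x y \<longrightarrow> coll H x y \<le> p1)"

definition hash_concat :: "('u \<Rightarrow> real) measure \<Rightarrow> nat \<Rightarrow> (nat \<Rightarrow> 'u \<Rightarrow> real) measure" where
  "hash_concat H i = Pi\<^sub>M {..<i} (\<lambda>_. H)"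

definition hash_apply :: "nat \<Rightarrow> (nat \<Rightarrow> 'u \<Rightarrow> real) \<Rightarrow> 'u \<Rightarrow> real list" where
  "hash_apply i hs x = map (\<lambda>l. hs l x) [0..<i]"

definition level_coll :: "('u \<Rightarrow> real) measure \<Rightarrow> nat \<Rightarrow> 'u \<Rightarrow> 'u \<Rightarrow> real" where
  "level_coll H i x y =
     measure (hash_concat H i)
       {hs \<in> space (hash_concat H i). hash_apply i hs x = hash_apply i hs y}"

text \<open>
  Levels range over \<open>{0..\<kappa>}\<close>, as in the definition of dense points; ties between
  minimizing levels may be broken in any way.
\<close>

definition optimal_level ::
  "('u \<Rightarrow> real) measure \<Rightarrow> real \<Rightarrow> nat \<Rightarrow> 'u set \<Rightarrow> 'u \<Rightarrow> nat \<Rightarrow> bool" where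
  "optimal_level H p1 \<kappa> T x k \<longleftrightarrow>
     is_arg_min (\<lambda>i. (1 / p1) ^ i * (1 + (\<Sum>y\<in>T. level_coll H i x y))) (\<lambda>i. i \<le> \<kappa>) k"

definition kappa :: "real \<Rightarrow> real \<Rightarrow> nat \<Rightarrow> nat" where
  "kappa p1 \<rho> p = nat \<lceil>\<rho> / (1 + \<rho>) * log (1 / p1) (real p)\<rceil>"


section \<open>Output quantities\<close>

definition near_count :: "('u \<Rightarrow> 'u \<Rightarrow> real) \<Rightarrow> real \<Rightarrow> 'u set \<Rightarrow> 'u \<Rightarrow> nat" where
  "near_count d r T x = card {y \<in> T. d x y \<le> r}"

definition dense :: "nat \<Rightarrow> real \<Rightarrow> nat \<Rightarrow> nat \<Rightarrow> nat \<Rightarrow> bool" where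
  "dense n p2 \<kappa> i N \<longleftrightarrow>
     (i < \<kappa> \<and> real n * p2 ^ (i + 1) \<le> real N \<and> real N < real n * p2 ^ i) \<or>
     (i = \<kappa> \<and> real N < real n * p2 ^ \<kappa>)"

definition OUT_near ::
  "('u \<Rightarrow> 'u \<Rightarrow> real) \<Rightarrow> real \<Rightarrow> real \<Rightarrow> nat \<Rightarrow> 'u set \<Rightarrow> 'u set \<Rightarrow> nat \<Rightarrow> nat" where
  "OUT_near d r p2 \<kappa> R S i =
     card {(x, y) \<in> R \<times> S. d x y \<le> r \<and>
             (dense (card R + card S) p2 \<kappa> i (near_count d r S x) \<or>
              dense (card R + card S) p2 \<kappa> i (near_count d r R y))}"

definition OUT_c_near ::
  "('u \<Rightarrow> 'u \<Rightarrow> real) \<Rightarrow> real \<Rightarrow> real \<Rightarrow> 'u set \<Rightarrow> 'u set \<Rightarrow> nat" where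
  "OUT_c_near d r c R S = card {(x, y) \<in> R \<times> S. r < d x y \<and> d x y \<le> c * r}"


section \<open>The similarity join algorithm\<close>

datatype side = R_side | S_side

datatype status = Active | Passive | Dead

definition status_at :: "nat \<Rightarrow> nat \<Rightarrow> status" where
  "status_at k i = (if i = k then Active else if i < k then Passive else Dead)"

datatype 'u word = Point 'u | Number real | Hash (un_Hash: "'u \<Rightarrow> real")

datatype 'u tup =
  Tup (level: nat) (rep: nat) (hash_val: "real list") (side_of: side) (point: 'u) (stat: status)

definition group_key :: "'u tup \<Rightarrow> real list" where
  "group_key \<tau> = real (level \<tau>) # real (rep \<tau>) # hash_val \<tau>"

definition tup_size :: "'u tup \<Rightarrow> nat" where
  "tup_size \<tau> = length (group_key \<tau>) + 3"

text \<open>Lexicographic order by group key, with the active tuples first in each group.\<close>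

definition tup_le :: "'u tup \<Rightarrow> 'u tup \<Rightarrow> bool" where
  "tup_le \<tau> \<tau>' \<longleftrightarrow>
     lexordp_eq (group_key \<tau> @ [if stat \<tau> = Active then 0 else 1])
                (group_key \<tau>' @ [if stat \<tau>' = Active then 0 else 1])"

definition opt_key_size :: "real list option \<Rightarrow> nat" where
  "opt_key_size m = (case m of None \<Rightarrow> 1 | Some g \<Rightarrow> Suc (length g))"

definition active_key :: "'u tup \<Rightarrow> real list option" where
  "active_key \<tau> = (if stat \<tau> = Active then Some (group_key \<tau>) else None)"

definition last_some :: "'b option \<Rightarrow> 'b option \<Rightarrow> 'b option" where
  "last_some a b = (case b of None \<Rightarrow> a | Some _ \<Rightarrow> b)"

text \<open>
  The broadcast words are the base hash functions \<open>l < i\<close> of the \<open>j\<close>-th concatenation drawn for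
  level \<open>i\<close>, in the order of the following list of slots.
\<close>

definition hash_slots :: "nat \<Rightarrow> (nat \<Rightarrow> nat) \<Rightarrow> (nat \<times> nat \<times> nat) list" where
  "hash_slots \<kappa> t = [(i, j, l). i \<leftarrow> [0..<Suc \<kappa>], j \<leftarrow> [0..<t i], l \<leftarrow> [0..<i]]"

definition encode_hashes ::
  "nat \<Rightarrow> (nat \<Rightarrow> nat) \<Rightarrow> (nat \<times> nat \<Rightarrow> nat \<Rightarrow> 'u \<Rightarrow> real) \<Rightarrow> 'u word list" where
  "encode_hashes \<kappa> t \<omega> = map (\<lambda>(i, j, l). Hash (\<omega> (i, j) l)) (hash_slots \<kappa> t)"

definition decode_hashes ::
  "nat \<Rightarrow> (nat \<Rightarrow> nat) \<Rightarrow> 'u word list \<Rightarrow> nat \<times> nat \<Rightarrow> nat \<Rightarrow> 'u \<Rightarrow> real" where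
  "decode_hashes \<kappa> t ws =
     (\<lambda>(i, j) l. un_Hash (the (map_of (zip (hash_slots \<kappa> t) ws) (i, j, l))))"

text \<open>A local input point is a triple of its relation, the point \<open>x\<close> and its level \<open>k\<close>.\<close>

definition gen_tuples ::
  "nat \<Rightarrow> (nat \<Rightarrow> nat) \<Rightarrow> 'u word list \<times> (side \<times> 'u \<times> nat) list \<Rightarrow> 'u tup list" where
  "gen_tuples \<kappa> t = (\<lambda>(ws, pts).
     [Tup i j (hash_apply i (decode_hashes \<kappa> t ws (i, j)) x) s x (status_at k i).
        (s, x, k) \<leftarrow> pts, i \<leftarrow> [0..<Suc \<kappa>], status_at k i \<noteq> Dead, j \<leftarrow> [0..<t i]])"

text \<open>
  After the prefix sums \<open>m\<close> is the group key of the last active tuple at or before \<open>\<tau>\<close> in sorted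
  order.
\<close>

definition discard :: "real list option list \<times> 'u tup list \<Rightarrow> 'u tup list" where
  "discard = (\<lambda>(ms, ts). [\<tau>. (m, \<tau>) \<leftarrow> zip ms ts, m = Some (group_key \<tau>)])"

definition select :: "side \<Rightarrow> status set \<Rightarrow> 'u tup list \<Rightarrow> 'u tup list" where
  "select s A ts = filter (\<lambda>\<tau>. side_of \<tau> = s \<and> stat \<tau> \<in> A) ts"

definition verify ::
  "('u \<Rightarrow> 'u \<Rightarrow> real) \<Rightarrow> real \<Rightarrow> ('u tup \<times> 'u tup) list \<Rightarrow> ('u \<times> 'u) list" where
  "verify d r ps = [(point a, point b). (a, b) \<leftarrow> ps, d (point a) (point b) \<le> r]"

text \<open>
  The pairs with at least one active tuple are generated by two equi-joins: active tuples of \<open>R\<close>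
  with all tuples of \<open>S\<close>, and passive tuples of \<open>R\<close> with active tuples of \<open>S\<close>.
\<close>

definition lsh_join ::
  "(nat \<Rightarrow> ('u word, 'u tup list, 'u tup list) protocol) \<Rightarrow>
   ((real list option \<Rightarrow> real list option \<Rightarrow> real list option) \<Rightarrow> nat \<Rightarrow>
      ('u word, real list option list, real list option list) protocol) \<Rightarrow>
   (nat \<Rightarrow> ('u word, 'u tup list \<times> 'u tup list, ('u tup \<times> 'u tup) list) protocol) \<Rightarrow>
   real \<Rightarrow> nat \<Rightarrow> nat \<Rightarrow> (nat \<Rightarrow> nat) \<Rightarrow> ('u \<Rightarrow> 'u \<Rightarrow> real) \<Rightarrow> real \<Rightarrow>
   ('u word, 'u word list \<times> (side \<times> 'u \<times> nat) list, ('u \<times> 'u) list) protocol" where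
  "lsh_join srt scan ejoin \<delta> p \<kappa> t d r =
     keeping (broadcast p (nat \<lceil>real p powr \<delta>\<rceil>) (nat \<lceil>1 / \<delta>\<rceil>)) >>>
     local_step (gen_tuples \<kappa> t) >>>
     srt p >>>
     local_step (\<lambda>ts. (map active_key ts, ts)) >>>
     keeping (scan last_some p) >>>
     local_step discard >>>
     local_step (\<lambda>ts. ((select R_side {Active} ts, select S_side {Active, Passive} ts), ts)) >>>
     keeping (ejoin p) >>>
     local_step (\<lambda>(ps, ts). ((select R_side {Passive} ts, select S_side {Active} ts), ps)) >>>
     keeping (ejoin p) >>>
     local_step (\<lambda>(ps', ps). verify d r (ps @ ps'))"

definition evenly_distributed :: "nat \<Rightarrow> 'u set \<Rightarrow> 'u set \<Rightarrow> (nat \<Rightarrow> (side \<times> 'u) list) \<Rightarrow> bool" where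
  "evenly_distributed p R S inp \<longleftrightarrow>
     distinct (gather p inp) \<and>
     set (gather p inp) = {R_side} \<times> R \<union> {S_side} \<times> S \<and>
     (\<forall>q<p. length (inp q) \<le> nat \<lceil>real (card R + card S) / real p\<rceil>)"

text \<open>Processor 0 draws the hash functions; every point comes with its level.\<close>

definition join_input ::
  "nat \<Rightarrow> (nat \<Rightarrow> nat) \<Rightarrow> (side \<Rightarrow> 'u \<Rightarrow> nat) \<Rightarrow> (nat \<Rightarrow> (side \<times> 'u) list) \<Rightarrow>
   (nat \<times> nat \<Rightarrow> nat \<Rightarrow> 'u \<Rightarrow> real) \<Rightarrow> nat \<Rightarrow> 'u word list \<times> (side \<times> 'u \<times> nat) list" where
  "join_input \<kappa> t k inp \<omega> q =
     (if q = 0 then encode_hashes \<kappa> t \<omega> else [], map (\<lambda>(s, x). (s, x, k s x)) (inp q))"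

definition hash_sample ::
  "('u \<Rightarrow> real) measure \<Rightarrow> nat \<Rightarrow> (nat \<Rightarrow> nat) \<Rightarrow> (nat \<times> nat \<Rightarrow> nat \<Rightarrow> 'u \<Rightarrow> real) measure" where
  "hash_sample H \<kappa> t = Pi\<^sub>M (SIGMA i:{..\<kappa>}. {..<t i}) (\<lambda>(i, j). hash_concat H i)"

text \<open>
  The expectation of \<open>f\<close> if \<open>f\<close> is measurable.  The load need not be a measurable function of the
  hash functions, as the primitives are arbitrary protocols, and \<^const>\<open>nn_integral\<close> would be a
  lower integral then.
\<close>

definition upper_expectation :: "'a measure \<Rightarrow> ('a \<Rightarrow> real) \<Rightarrow> ennreal" where
  "upper_expectation M f =
     (INF g\<in>{g \<in> borel_measurable M. \<forall>\<omega>\<in>space M. ennreal (f \<omega>) \<le> g \<omega>}. \<integral>\<^sup>+\<omega>. g \<omega> \<partial>M)"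

end

theory Submission
  imports Defs
begin

text \<open>
  Broadcasting the hash functions, creating the tuples, sorting and scanning costs
  \<open>n / p powr (1 / (1 + \<rho>))\<close> up to logarithms, since \<open>(1 / p1) ^ \<kappa>\<close> is about \<open>p powr (\<rho> / (1 + \<rho>))\<close>.
  What remains is the expected output size of the two equi-joins.  A point \<open>x\<close> active in phase
  \<open>k\<close> contributes the expected \<open>t k * (\<Sum>y. level_coll H k x y)\<close> pairs.  As \<open>k\<close> minimizes the cost,
  it may be replaced by the level \<open>i\<close> for which \<open>x\<close> is \<open>i\<close>-dense.  At that level the near points
  cost \<open>(1 / p1) ^ i\<close> each, every \<open>c\<close>-near point costs at most 1, and the far points cost at most
  \<open>n * (p2 / p1) ^ i\<close> in total, which for \<open>i < \<kappa>\<close> is absorbed by the near points, of which there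
  are at least \<open>n * p2 ^ (i + 1)\<close>, and for \<open>i = \<kappa>\<close> adds up to at most the square of the last term
  of the bound (times \<open>p\<close>).
\<close>

section \<open>Composition of protocols and broadcast\<close>

text \<open>The join output enters the load under a square root, whereas only its expectation is
  estimated, and the load need not be measurable. Both obstacles are met by a pointwise majorant
  that is integrable and affine in the collision counts. The exponent
  \<open>\<rho> / (1 + \<rho>)\<close> in \<open>\<kappa>\<close> is a balance point. With \<beta> =
  1 / (1 + \<rho>), the unrounded level turns powers of \<open>1 / p1\<close> and \<open>p2\<close>
  into \<open>p powr (1 - \<beta>)\<close> and \<open>p powr - \<beta>\<close>. Replicating the
  points thus costs about n / p^\<beta> per processor, and the far collisions left at level \<kappa>
  contribute about the square of this to the join size divided by p. Rounding \<kappa> up, and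
  moving between neighbouring density thresholds, each lose a factor of at most
  \<open>1 / lo\<close>. The condition p < n^\<epsilon> is used as p^(1 + \<delta>) \<le> n. It pays
  twice: for the input size that the primitives require, and for a broadcast with fan-out about
  p^\<delta> and constant depth. The logarithms have two sources: a tuple or a concatenated hash
  function occupies up to about \<kappa> words, and the repetitions are summed over \<kappa> + 1
  levels.\<close>

lemma length_history [simp]: "length (history P p inp t q) = t"
  by (induction t arbitrary: q) auto

lemma history_seq_comp_left:
  "t \<le> rounds P \<Longrightarrow> history (P >>> Q) p inp t = history P p inp t"
proof (induction t)
  case (Suc t)
  then show ?case
    by (auto simp: fun_eq_iff seq_comp_def)
qed auto

text \<open>A history after t rounds has exactly t entries, so \<open>take (rounds P)\<close> and
  \<open>drop (rounds P)\<close> in the definition of \<open>>>>\<close> cut it precisely where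
  \<open>Q\<close> starts.\<close>

lemma history_seq_comp_right:
  "history (P >>> Q) p inp (rounds P + t) q =
     history P p inp (rounds P) q @ history Q p (result P p inp) t q"
proof (induction t arbitrary: q)
  case 0
  then show ?case by (simp add: history_seq_comp_left)
next
  case (Suc t)
  have "send (P >>> Q) (rounds P + t) s (inp s)
          (history P p inp (rounds P) s @ history Q p (result P p inp) t s)
      = send Q t s (result P p inp s) (history Q p (result P p inp) t s)" for s
    by (simp add: seq_comp_def result_def)
  then show ?case
    by (simp add: Suc.IH cong: if_cong)
qed

lemma rounds_seq_comp [simp]: "rounds (P >>> Q) = rounds P + rounds Q"
  by (simp add: seq_comp_def)

lemma result_seq_comp [simp]: "result (P >>> Q) p inp = result Q p (result P p inp)"
proof
  fix q
  show "result (P >>> Q) p inp q = result Q p (result P p inp) q"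
    unfolding result_def[of "P >>> Q"] result_def[of Q] rounds_seq_comp history_seq_comp_right
    by (simp add: seq_comp_def result_def)
qed

lemma message_seq_comp_left:
  "t < rounds P \<Longrightarrow> message (P >>> Q) p inp t = message P p inp t"
  by (auto simp: fun_eq_iff message_def history_seq_comp_left) (simp add: seq_comp_def)

lemma message_seq_comp_right:
  "message (P >>> Q) p inp (rounds P + t) = message Q p (result P p inp) t"
  by (auto simp: fun_eq_iff message_def history_seq_comp_right) (simp add: seq_comp_def result_def)

lemma load_le_iff:
  "load P p inp \<le> b \<longleftrightarrow> (\<forall>t<rounds P. \<forall>q<p. sent P p inp t q \<le> b \<and> received P p inp t q \<le> b)"
  unfolding load_def by (subst Max_le_iff) auto

text \<open>Every round of the composition is a round of one component, so the larger of the two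
  loads bounds it. The sum is a convenient weakening that costs only a constant factor for a fixed
  number of components.\<close>

lemma load_seq_comp: "load (P >>> Q) p inp \<le> load P p inp + load Q p (result P p inp)"
proof -
  have P: "sent P p inp t q \<le> load P p inp \<and> received P p inp t q \<le> load P p inp"
    if "t < rounds P" "q < p" for t q
    using load_le_iff[of P p inp "load P p inp"] that by simp
  have Q: "sent Q p inp t q \<le> load Q p inp \<and> received Q p inp t q \<le> load Q p inp"
    if "t < rounds Q" "q < p" for t q inp
    using load_le_iff[of Q p inp "load Q p inp"] that by simp
  show ?thesis
    unfolding load_le_iff
  proof (intro allI impI)
    fix t q assume t: "t < rounds (P >>> Q)" and q: "q < p"
    show "sent (P >>> Q) p inp t q \<le> load P p inp + load Q p (result P p inp) \<and>
          received (P >>> Q) p inp t q \<le> load P p inp + load Q p (result P p inp)"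
    proof (cases "t < rounds P")
      case True
      with P[OF True q] show ?thesis
        by (simp add: sent_def received_def message_seq_comp_left)
    next
      case False
      define s where "s = t - rounds P"
      have ts: "t = rounds P + s" and s: "s < rounds Q"
        using False t by (auto simp: s_def)
      from Q[OF s q, of "result P p inp"] show ?thesis
        by (simp add: ts sent_def received_def message_seq_comp_right)
    qed
  qed
qed

lemma rounds_local_step [simp]: "rounds (local_step f) = 0"
  by (simp add: local_step_def)

lemma result_local_step [simp]: "result (local_step f) p inp = f \<circ> inp"
  by (auto simp: fun_eq_iff result_def local_step_def)

lemma load_local_step [simp]: "load (local_step f) p inp = 0"
  using load_le_iff[of "local_step f" p inp 0] by simp

lemma rounds_keeping [simp]: "rounds (keeping P) = rounds P"
  by (simp add: keeping_def)

lemma history_keeping: "history (keeping P) p inp t = history P p (fst \<circ> inp) t"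
  by (induction t) (auto simp: fun_eq_iff keeping_def)

lemma result_keeping [simp]:
  "result (keeping P) p inp = (\<lambda>q. (result P p (fst \<circ> inp) q, snd (inp q)))"
  by (auto simp: fun_eq_iff result_def history_keeping) (auto simp: keeping_def)

lemma load_keeping [simp]: "load (keeping P) p inp = load P p (fst \<circ> inp)"
proof -
  have "message (keeping P) p inp = message P p (fst \<circ> inp)"
    by (auto simp: fun_eq_iff message_def history_keeping) (auto simp: keeping_def)
  then show ?thesis
    by (simp add: load_def sent_def received_def)
qed

section \<open>Correctness and load of the tree broadcast\<close>

lemma broadcast_known_snoc:
  "broadcast_known p q x (h @ [m]) =
     (if q = 0 then x else broadcast_known p q x h @ concat (map m [0..<p]))"
  by (simp add: broadcast_known_def)

lemma concat_map_singleton: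
  "a < p \<Longrightarrow> concat (map (\<lambda>s. if s = a then w else []) [0..<p]) = w"
proof (induction p)
  case (Suc p)
  have [simp]: "concat (map (\<lambda>s. if s = p then w else []) [0..<p]) = []"
    by (simp add: concat_eq_Nil_conv)
  show ?case
    using Suc by (cases "a = p") (auto simp: concat_eq_Nil_conv)
qed simp

text \<open>A processor other than 0 is reached in a single round and by a single sender. Hence the
  concatenation of everything it ever received is one copy of the words and not several.\<close>

lemma broadcast_invariant:
  assumes inp: "\<And>q. 0 < q \<Longrightarrow> q < p \<Longrightarrow> inp q = []" and "1 \<le> f" and "q < p"
  shows "broadcast_known p q (inp q) (history (broadcast p f D) p inp t q) =
           (if q < f ^ t then inp 0 else [])"
  using \<open>q < p\<close>
proof (induction t arbitrary: q)
  case 0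
  then show ?case
    using inp[of q] by (auto simp: broadcast_known_def)
next
  case (Suc t)
  let ?h = "history (broadcast p f D) p inp t"
  have le: "f ^ t \<le> f ^ Suc t"
    using \<open>1 \<le> f\<close> by simp
  show ?case
  proof (cases "q = 0")
    case True
    then show ?thesis using \<open>1 \<le> f\<close> by (simp add: broadcast_known_def)
  next
    case False
    \<comment> \<open>\<open>B\<close> says that \<open>q\<close> is reached in round
      \<open>t\<close>. Its sender \<open>q mod f ^ t\<close> lies below \<open>f ^ t\<close>, so by
      the induction hypothesis it already knows the words, and it is at most \<open>q\<close>, hence
      a processor.\<close>
    define B where "B \<longleftrightarrow> f ^ t \<le> q \<and> q < f ^ Suc t"
    define m where "m s = (if s < p then send (broadcast p f D) t s (inp s) (?h s) q else [])" for s
    have mm: "m s = (if s = q mod f ^ t then if B then inp 0 else [] else [])" if "s < p" for s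
    proof -
      have "q mod f ^ t < f ^ t" using \<open>1 \<le> f\<close> by simp
      then show ?thesis
        using Suc.IH[OF that] that by (auto simp: m_def broadcast_def B_def)
    qed
    have "concat (map m [0..<p]) =
       concat (map (\<lambda>s. if s = q mod f ^ t then if B then inp 0 else [] else []) [0..<p])"
      by (intro arg_cong[where f = concat] map_cong) (auto simp: mm)
    also have "\<dots> = (if B then inp 0 else [])"
      using Suc.prems by (intro concat_map_singleton) (use le_less_trans mod_less_eq_dividend in blast)
    finally have c: "concat (map m [0..<p]) = (if B then inp 0 else [])" .
    have "history (broadcast p f D) p inp (Suc t) q = ?h q @ [m]"
      by (simp add: m_def fun_eq_iff)
    then have "broadcast_known p q (inp q) (history (broadcast p f D) p inp (Suc t) q) =
        (if q < f ^ t then inp 0 else []) @ (if B then inp 0 else [])"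
      using False Suc.IH[OF Suc.prems] c by (simp only: broadcast_known_snoc) simp
    then show ?thesis
      using le unfolding B_def by (auto simp del: power_Suc history.simps)
  qed
qed

lemma result_broadcast:
  assumes "\<And>q. 0 < q \<Longrightarrow> q < p \<Longrightarrow> inp q = []" "1 \<le> f" "p \<le> f ^ D" "q < p"
  shows "result (broadcast p f D) p inp q = inp 0"
  using broadcast_invariant[where t = D and D = D, OF assms(1,2,4)] assms(3,4)
  by (simp add: result_def broadcast_def)

lemma rounds_broadcast [simp]: "rounds (broadcast p f D) = D"
  by (simp add: broadcast_def)

text \<open>The targets of a sender in round \<open>t\<close> lie in one residue class modulo
  \<open>f ^ t\<close> and below \<open>f ^ Suc t\<close>, so their quotients by
  \<open>f ^ t\<close> are distinct numbers below \<open>f\<close>. A receiver has only one possible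
  sender.\<close>

lemma load_broadcast:
  assumes inp: "\<And>q. 0 < q \<Longrightarrow> q < p \<Longrightarrow> inp q = []" and f: "1 \<le> f"
  shows "load (broadcast p f D) p inp \<le> f * length (inp 0)"
proof -
  have msg: "length (message (broadcast p f D) p inp t q q') =
      (if f ^ t \<le> q' \<and> q' < f ^ Suc t \<and> q' mod f ^ t = q then length (inp 0) else 0)"
    if "q < p" for t q q'
  proof -
    have "broadcast_known p q (inp q) (history (broadcast p f D) p inp t q) =
        (if q < f ^ t then inp 0 else [])"
      by (rule broadcast_invariant[OF inp f that])
    moreover have "q' mod f ^ t < f ^ t" using f by simp
    moreover have "message (broadcast p f D) p inp t q q' =
        (if f ^ t \<le> q' \<and> q' < f ^ Suc t \<and> q' mod f ^ t = q
         then broadcast_known p q (inp q) (history (broadcast p f D) p inp t q) else [])"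
      by (simp add: message_def) (simp add: broadcast_def)
    ultimately show ?thesis
      by auto
  qed
  have "sent (broadcast p f D) p inp t q \<le> f * length (inp 0)" if "q < p" for t q
  proof -
    let ?A = "{q'. q' < p \<and> f ^ t \<le> q' \<and> q' < f ^ Suc t \<and> q' mod f ^ t = q}"
    have "sent (broadcast p f D) p inp t q = card ?A * length (inp 0)"
      unfolding sent_def msg[OF that] by (simp add: sum.If_cases Int_def)
    moreover have "inj_on (\<lambda>q'. q' div f ^ t) ?A"
    proof (rule inj_onI)
      fix x y assume "x \<in> ?A" "y \<in> ?A" "x div f ^ t = y div f ^ t"
      then show "x = y" by (metis (mono_tags, lifting) div_mult_mod_eq mem_Collect_eq)
    qed
    then have "card ?A \<le> card {..<f}"
    proof (rule card_inj_on_le)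
      show "(\<lambda>q'. q' div f ^ t) ` ?A \<subseteq> {..<f}"
        by (auto simp: less_mult_imp_div_less)
    qed simp
    ultimately show ?thesis by simp
  qed
  moreover have "received (broadcast p f D) p inp t q \<le> f * length (inp 0)" for t q
  proof -
    have "received (broadcast p f D) p inp t q \<le>
       (\<Sum>q'<p. if q mod f ^ t = q' then length (inp 0) else 0)"
      unfolding received_def by (rule sum_mono) (auto simp: msg)
    also have "\<dots> \<le> 1 * length (inp 0)" by simp
    also have "\<dots> \<le> f * length (inp 0)"
      using f by (intro mult_right_mono) auto
    finally show ?thesis .
  qed
  ultimately show ?thesis
    unfolding load_le_iff by blast
qed

section \<open>Size of the equi-joins\<close>

lemma mset_gather_mono:
  "(\<And>q. q < p \<Longrightarrow> mset (f q) \<subseteq># mset (g q)) \<Longrightarrow> mset (gather p f) \<subseteq># mset (gather p g)"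
  by (induction p) (auto simp: gather_def intro!: subset_mset.add_mono)

lemma set_gather: "set (gather p f) = (\<Union>q<p. set (f q))"
  by (auto simp: gather_def)

lemma select_gather: "gather p (\<lambda>q. select s A (f q)) = select s A (gather p f)"
  by (induction p) (auto simp: gather_def select_def)

lemma mset_select_mono:
  "mset xs \<subseteq># mset ys \<Longrightarrow> mset (select s A xs) \<subseteq># mset (select s A ys)"
  by (simp add: select_def multiset_filter_mono)

text \<open>This form depends on the multisets of the two relations alone, which is all that is
  retained about the sorted and thinned-out tuples, and it makes monotonicity visible.\<close>

lemma length_equi_join:
  "length (equi_join key xs ys) =
     (\<Sum>a\<in>#mset xs. size (filter_mset (\<lambda>b. key a = key b) (mset ys)))"
proof (induction xs)
  case (Cons a xs)
  have "length (concat (map (\<lambda>b. if key a = key b then [(a, b)] else []) ys)) =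
        size (filter_mset (\<lambda>b. key a = key b) (mset ys))"
    by (induction ys) auto
  with Cons show ?case by (simp add: equi_join_def)
qed (simp add: equi_join_def)

lemma length_equi_join_mono:
  assumes "mset xs \<subseteq># mset xs'" "mset ys \<subseteq># mset ys'"
  shows "length (equi_join key xs ys) \<le> length (equi_join key xs' ys')"
proof -
  have "(\<Sum>a\<in>#mset xs. size (filter_mset (\<lambda>b. key a = key b) (mset ys))) \<le>
        (\<Sum>a\<in>#mset xs. size (filter_mset (\<lambda>b. key a = key b) (mset ys')))"
    using assms(2) by (intro sum_mset_mono size_mset_mono multiset_filter_mono)
  also have "\<dots> \<le> (\<Sum>a\<in>#mset xs'. size (filter_mset (\<lambda>b. key a = key b) (mset ys')))"
    using assms(1) by (auto simp: mset_subset_eq_exists_conv)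
  finally show ?thesis by (simp add: length_equi_join)
qed

lemma length_equi_join_sum_list:
  "length (equi_join key xs ys) = (\<Sum>a\<leftarrow>xs. \<Sum>b\<leftarrow>ys. if key a = key b then 1 else 0)"
proof (induction xs)
  case (Cons a xs)
  have "length (concat (map (\<lambda>b. if key a = key b then [(a, b)] else []) ys)) =
        (\<Sum>b\<leftarrow>ys. if key a = key b then 1 else 0)"
    by (induction ys) auto
  with Cons show ?case by (simp add: equi_join_def)
qed (simp add: equi_join_def)

text \<open>Collisions are counted with the active tuples on the left, but the second join has them
  on the right.\<close>

lemma length_equi_join_commute: "length (equi_join key xs ys) = length (equi_join key ys xs)"
proof -
  have "(\<Sum>a\<leftarrow>xs. \<Sum>b\<leftarrow>ys. if key a = key b then 1 else 0) =
        (\<Sum>b\<leftarrow>ys. \<Sum>a\<leftarrow>xs. if key b = key a then 1 else (0::nat))"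
    by (induction xs) (auto simp: sum_list_addf eq_commute)
  then show ?thesis
    by (simp add: length_equi_join_sum_list)
qed

lemma mset_discard: "mset (discard (ms, ts)) \<subseteq># mset ts"
proof (induction ms ts rule: list_induct2')
  case (4 m ms \<tau> ts)
  then show ?case
    by (auto simp: discard_def intro: subset_mset.order_trans)
qed (auto simp: discard_def)

section \<open>Decoding the hash functions and summing over the generated tuples\<close>

lemma set_hash_slots: "set (hash_slots \<kappa> t) = {(i, j, l). i \<le> \<kappa> \<and> j < t i \<and> l < i}"
  by (auto simp: hash_slots_def image_iff simp del: upt_Suc)

lemma length_hash_slots: "length (hash_slots \<kappa> t) = (\<Sum>i\<le>\<kappa>. t i * i)"
  by (simp add: hash_slots_def length_concat o_def interv_sum_list_conv_sum_set_nat
      atLeast0LessThan lessThan_Suc_atMost sum_list_triv del: upt_Suc)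

lemma decode_encode_hashes:
  assumes "i \<le> \<kappa>" "j < t i" "l < i"
  shows "decode_hashes \<kappa> t (encode_hashes \<kappa> t \<omega>) (i, j) l = \<omega> (i, j) l"
  using assms by (simp add: decode_hashes_def encode_hashes_def map_of_zip_map set_hash_slots)

lemma sum_list_concat_map:
  "sum_list (map f (concat (map g xs))) = (\<Sum>x\<leftarrow>xs. sum_list (map f (g x)))"
  by (induction xs) auto

lemma sum_list_upt: "(\<Sum>i\<leftarrow>[0..<n]. f i) = (\<Sum>i<n. f i)"
  by (simp add: interv_sum_list_conv_sum_set_nat atLeast0LessThan)

text \<open>The encoding of the hash functions as words disappears here: sums over tuples refer to
  \<open>\<omega>\<close> directly. A constant summand counts the tuples, and a key comparison
  counts join results.\<close>

lemma sum_list_gen_tuples: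
  fixes f :: "'u tup \<Rightarrow> 'a::comm_monoid_add"
  shows "sum_list (map f (gen_tuples \<kappa> t (encode_hashes \<kappa> t \<omega>, pts))) =
    (\<Sum>(s, x, k)\<leftarrow>pts. \<Sum>i\<le>\<kappa>. \<Sum>j<t i. if status_at k i \<noteq> Dead
       then f (Tup i j (hash_apply i (\<omega> (i, j)) x) s x (status_at k i)) else 0)"
proof -
  have h: "hash_apply i (decode_hashes \<kappa> t (encode_hashes \<kappa> t \<omega>) (i, j)) x = hash_apply i (\<omega> (i, j)) x"
    if "i \<le> \<kappa>" "j < t i" for i j x
    using that by (auto simp: hash_apply_def decode_encode_hashes)
  have "(\<Sum>j<t i. f (Tup i j (hash_apply i (decode_hashes \<kappa> t (encode_hashes \<kappa> t \<omega>) (i, j)) x) s x st))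
      = (\<Sum>j<t i. f (Tup i j (hash_apply i (\<omega> (i, j)) x) s x st))" if "i \<le> \<kappa>" for i s x st
    using that by (intro sum.cong) (auto simp: h)
  then show ?thesis
    unfolding gen_tuples_def
    by (auto simp: sum_list_concat_map sum_list_upt lessThan_Suc_atMost o_def if_distrib
        intro!: arg_cong[where f = sum_list] sum.cong simp del: upt_Suc)
qed

lemma gather_gen_tuples:
  "gather p (\<lambda>q. gen_tuples \<kappa> t (ws, pts q)) = gen_tuples \<kappa> t (ws, gather p pts)"
  by (induction p) (auto simp: gather_def gen_tuples_def)

lemma length_gen_tuples:
  "length (gen_tuples \<kappa> t (encode_hashes \<kappa> t \<omega>, pts)) \<le> length pts * (\<Sum>i\<le>\<kappa>. t i)"
proof -
  have "length (gen_tuples \<kappa> t (encode_hashes \<kappa> t \<omega>, pts)) =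
     sum_list (map (\<lambda>_. 1) (gen_tuples \<kappa> t (encode_hashes \<kappa> t \<omega>, pts)))"
    by (simp add: sum_list_triv)
  also have "\<dots> \<le> (\<Sum>(s, x, k)\<leftarrow>pts. \<Sum>i\<le>\<kappa>. t i)"
    unfolding sum_list_gen_tuples by (auto intro!: sum_list_mono sum_mono)
  also have "\<dots> = length pts * (\<Sum>i\<le>\<kappa>. t i)"
    by (simp add: case_prod_unfold sum_list_triv)
  finally show ?thesis .
qed

text \<open>Of the 5 extra words, two are the level and the repetition inside the group key, and
  three are the fields outside it.\<close>

lemma tup_size_gen_tuples: "\<tau> \<in> set (gen_tuples \<kappa> t (ws, pts)) \<Longrightarrow> tup_size \<tau> \<le> \<kappa> + 5"
  by (auto simp: gen_tuples_def tup_size_def group_key_def hash_apply_def split: if_splits simp del: upt_Suc)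

text \<open>The partner \<open>y\<close> ranges over all points of side \<open>s'\<close>, dead or
  not, and is hashed at the level of \<open>x\<close>. This overcounts the join but makes the
  expectation a plain sum of collision probabilities.\<close>

definition active_collisions ::
  "(nat \<Rightarrow> nat) \<Rightarrow> (side \<Rightarrow> 'u \<Rightarrow> nat) \<Rightarrow> (side \<times> 'u) set \<Rightarrow>
     (nat \<times> nat \<Rightarrow> nat \<Rightarrow> 'u \<Rightarrow> real) \<Rightarrow> side \<Rightarrow> side \<Rightarrow> nat" where
  "active_collisions t k Z \<omega> s s' =
     (\<Sum>x | (s, x) \<in> Z. \<Sum>j<t (k s x). \<Sum>y | (s', y) \<in> Z.
        if hash_apply (k s x) (\<omega> (k s x, j)) x = hash_apply (k s x) (\<omega> (k s x, j)) y then 1 else 0)"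

lemma sum_side:
  assumes "finite Z"
  shows "(\<Sum>(s', x)\<in>Z. if s' = s then f x else 0) = (\<Sum>x | (s, x) \<in> Z. f x :: nat)"
proof -
  have "(\<Sum>(s', x)\<in>Z. if s' = s then f x else 0) = (\<Sum>z\<in>{z \<in> Z. fst z = s}. f (snd z))"
    using assms by (simp add: case_prod_unfold sum.inter_filter)
  also have "\<dots> = (\<Sum>x | (s, x) \<in> Z. f x)"
    by (rule sum.reindex_bij_witness[of _ "\<lambda>x. (s, x)" snd]) auto
  finally show ?thesis .
qed

text \<open>A point has active tuples at its own level only, and since the group key contains level
  and repetition, each partner point has at most one tuple matching a given tuple. The status set
  \<open>A\<close> of the partners is arbitrary, so that both joins are covered.\<close>

lemma length_equi_join_active:
  fixes \<kappa> :: nat and t :: "nat \<Rightarrow> nat" and k :: "side \<Rightarrow> 'u \<Rightarrow> nat"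
    and \<omega> :: "nat \<times> nat \<Rightarrow> nat \<Rightarrow> 'u \<Rightarrow> real"
  assumes "distinct zs"
  defines "g \<equiv> gen_tuples \<kappa> t (encode_hashes \<kappa> t \<omega>, map (\<lambda>(s, x). (s, x, k s x)) zs)"
  shows "length (equi_join group_key (select s {Active} g) (select s' A g))
           \<le> active_collisions t k (set zs) \<omega> s s'"
proof -
  define col where "col i j x y = (if hash_apply i (\<omega> (i, j)) x = hash_apply i (\<omega> (i, j)) y then 1 else 0 :: nat)"
    for i j x y
  have pts: "(\<Sum>(s, x, k)\<leftarrow>map (\<lambda>(s, x). (s, x, k s x)) zs. F s x k) = (\<Sum>(s, x)\<in>set zs. F s x (k s x))"
    for F :: "side \<Rightarrow> 'u \<Rightarrow> nat \<Rightarrow> nat"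
    using assms(1) by (simp add: o_def case_prod_unfold sum_list_distinct_conv_sum_set)
  have filt: "sum_list (map f (select s A ts)) =
      (\<Sum>\<tau>\<leftarrow>ts. if side_of \<tau> = s \<and> stat \<tau> \<in> A then f \<tau> else 0)" for f :: "'u tup \<Rightarrow> nat" and s A ts
    by (simp add: select_def sum_list_map_filter')
  \<comment> \<open>For a fixed left tuple the key equation selects one level \<open>i'\<close> and
    one repetition \<open>j'\<close>, so the double sum over the tuples of \<open>y\<close>
    collapses to a single term.\<close>
  have inner: "(\<Sum>b\<leftarrow>select s' A g. if group_key (Tup i j (hash_apply i (\<omega> (i, j)) x) s x st) = group_key b then 1 else 0)
     \<le> (\<Sum>y | (s', y) \<in> set zs. col i j x y)" for i j x st
  proof -
    have "(\<Sum>i'\<le>\<kappa>. \<Sum>j'<t i'. if status_at k' i' \<noteq> Dead then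
        if s'' = s' \<and> status_at k' i' \<in> A then
        if i = i' \<and> j = j' \<and> hash_apply i (\<omega> (i, j)) x = hash_apply i' (\<omega> (i', j')) y then 1 else 0 else 0 else 0)
      \<le> (if s'' = s' then col i j x y else 0)" for s'' y k'
    proof -
      have "(\<Sum>i'\<le>\<kappa>. \<Sum>j'<t i'. if status_at k' i' \<noteq> Dead then
        if s'' = s' \<and> status_at k' i' \<in> A then
        if i = i' \<and> j = j' \<and> hash_apply i (\<omega> (i, j)) x = hash_apply i' (\<omega> (i', j')) y then 1 else 0 else 0 else 0)
        \<le> (\<Sum>i'\<le>\<kappa>. \<Sum>j'<t i'. if i = i' \<and> j = j' then if s'' = s' then col i j x y else 0 else 0)"
        unfolding col_def by (intro sum_mono) auto
      also have "\<dots> \<le> (\<Sum>i'\<le>\<kappa>. if i = i' then if s'' = s' then col i j x y else 0 else 0)"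
        by (intro sum_mono) auto
      also have "\<dots> \<le> (if s'' = s' then col i j x y else 0)"
        by auto
      finally show ?thesis .
    qed
    then have "(\<Sum>b\<leftarrow>select s' A g. if group_key (Tup i j (hash_apply i (\<omega> (i, j)) x) s x st) = group_key b then 1 else 0)
        \<le> (\<Sum>(s'', y)\<in>set zs. if s'' = s' then col i j x y else 0)"
      unfolding filt unfolding g_def sum_list_gen_tuples pts
      by (intro sum_mono) (auto simp: group_key_def cong: if_cong)
    then show ?thesis by (simp add: sum_side)
  qed
  have "length (equi_join group_key (select s {Active} g) (select s' A g)) =
     (\<Sum>a\<leftarrow>g. if side_of a = s \<and> stat a \<in> {Active} then
        (\<Sum>b\<leftarrow>select s' A g. if group_key a = group_key b then 1 else 0) else 0)"
    unfolding length_equi_join_sum_list filt ..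
  also have "\<dots> = (\<Sum>(s'', x)\<in>set zs. \<Sum>i\<le>\<kappa>. \<Sum>j<t i. if status_at (k s'' x) i \<noteq> Dead then
       if s'' = s \<and> status_at (k s'' x) i = Active then
        (\<Sum>b\<leftarrow>select s' A g. if group_key (Tup i j (hash_apply i (\<omega> (i, j)) x) s'' x (status_at (k s'' x) i))
            = group_key b then 1 else 0) else 0 else 0)"
    by (subst (1) g_def, unfold sum_list_gen_tuples pts) (simp cong: if_cong)
  \<comment> \<open>Being active forces \<open>i = k s x\<close>, which removes the sum over levels
    of the left point.\<close>
  also have "\<dots> \<le> (\<Sum>(s'', x)\<in>set zs. \<Sum>i\<le>\<kappa>. if s'' = s \<and> i = k s x then
       \<Sum>j<t i. \<Sum>y | (s', y) \<in> set zs. col i j x y else 0)"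
    unfolding case_prod_unfold
    by (intro sum_mono) (auto simp: status_at_def intro!: sum_mono inner)
  also have "\<dots> \<le> (\<Sum>(s'', x)\<in>set zs. if s'' = s then
       \<Sum>j<t (k s x). \<Sum>y | (s', y) \<in> set zs. col (k s x) j x y else 0)"
    by (intro sum_mono) auto
  also have "\<dots> = active_collisions t k (set zs) \<omega> s s'"
    by (simp add: sum_side active_collisions_def col_def)
  finally show ?thesis .
qed

section \<open>The load for fixed hash functions\<close>

lemma load_seq_comp_le:
  "load P p inp \<le> a \<Longrightarrow> load Q p (result P p inp) \<le> b \<Longrightarrow> load (P >>> Q) p inp \<le> a + b"
  using load_seq_comp[of P Q p inp] by linarith

lemma length_select_select:
  "s \<noteq> s' \<Longrightarrow> length (select s A xs) + length (select s' B xs) \<le> length xs"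
  by (induction xs) (auto simp: select_def)

text \<open>Without rounding, fan-out \<open>p powr \<delta>\<close> and depth
  \<open>1 / \<delta>\<close> reach exactly \<open>p\<close>; rounding both up only helps. The depth
  does not depend on \<open>p\<close>, which keeps the number of rounds constant.\<close>

lemma broadcast_depth:
  assumes "0 < \<delta>" "1 \<le> p"
  shows "p \<le> nat \<lceil>real p powr \<delta>\<rceil> ^ nat \<lceil>1 / \<delta>\<rceil>"
proof -
  have "real p = (real p powr \<delta>) powr (1 / \<delta>)"
    using assms by (simp add: powr_powr)
  also have "\<dots> \<le> (real p powr \<delta>) powr real (nat \<lceil>1 / \<delta>\<rceil>)"
    using assms by (intro powr_mono) (auto simp: ge_one_powr_ge_zero)
  also have "\<dots> = (real p powr \<delta>) ^ nat \<lceil>1 / \<delta>\<rceil>"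
    using assms by (intro powr_realpow) auto
  also have "\<dots> \<le> real (nat \<lceil>real p powr \<delta>\<rceil>) ^ nat \<lceil>1 / \<delta>\<rceil>"
    by (intro power_mono) (auto intro: real_nat_ceiling_ge)
  finally show ?thesis
    by (simp only: of_nat_power[symmetric] of_nat_le_iff)
qed

text \<open>
  Neither sortedness nor the values of the prefix sums matter for the load: discarding tuples only
  removes elements, and the size of an equi-join is monotone in the multisets being joined.
\<close>

lemma load_lsh_join:
  fixes srt :: "nat \<Rightarrow> ('u word, 'u tup list, 'u tup list) protocol"
    and scan :: "(real list option \<Rightarrow> real list option \<Rightarrow> real list option) \<Rightarrow> nat \<Rightarrow>
      ('u word, real list option list, real list option list) protocol"
    and ejoin :: "nat \<Rightarrow> ('u word, 'u tup list \<times> 'u tup list, ('u tup \<times> 'u tup) list) protocol"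
  assumes \<delta>: "0 < \<delta>"
    and "sorting_primitive tup_size tup_le \<delta> srt"
    and "prefix_sums_primitive opt_key_size \<delta> scan"
    and "equi_join_primitive tup_size group_key \<delta> ejoin"
  obtains K C where "1 \<le> C" and "\<And>p \<kappa> t d r inp k \<omega> L.
    1 \<le> p \<Longrightarrow> real p powr \<delta> \<le> real L \<Longrightarrow> distinct (gather p inp) \<Longrightarrow>
    \<forall>q<p. length (inp q) * (\<Sum>i\<le>\<kappa>. t i) \<le> L \<Longrightarrow>
    rounds (lsh_join srt scan ejoin \<delta> p \<kappa> t d r) \<le> K \<and>
    real (load (lsh_join srt scan ejoin \<delta> p \<kappa> t d r) p (join_input \<kappa> t k inp \<omega>)) \<le>
      real (nat \<lceil>real p powr \<delta>\<rceil> * length (hash_slots \<kappa> t)) +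
      C * real (\<kappa> + 5) * (real L +
        sqrt (real (active_collisions t k (set (gather p inp)) \<omega> R_side S_side) / real p) +
        sqrt (real (active_collisions t k (set (gather p inp)) \<omega> S_side R_side) / real p))"
proof -
  obtain K1 C1 where srt: "\<And>p. 1 \<le> p \<Longrightarrow> rounds (srt p) \<le> K1 \<and>
       (\<forall>inp (L::nat) (W::nat).
          real p powr \<delta> \<le> real L \<and> 1 \<le> W \<and>
          (\<forall>q<p. length (inp q) \<le> L \<and> (\<forall>a\<in>set (inp q). tup_size a \<le> W)) \<longrightarrow>
          mset (gather p (result (srt p) p inp)) = mset (gather p inp) \<and>
          sorted_wrt tup_le (gather p (result (srt p) p inp)) \<and>
          (\<forall>q<p. real (length (result (srt p) p inp q)) \<le> C1 * real L) \<and>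
          real (load (srt p) p inp) \<le> C1 * real W * real L)"
    using assms(2) unfolding sorting_primitive_def by auto
  obtain K2 C2 where scan: "\<And>f p. 1 \<le> p \<Longrightarrow> rounds (scan f p) \<le> K2 \<and>
       (\<forall>inp A (L::nat) (W::nat).
          real p powr \<delta> \<le> real L \<and> 1 \<le> W \<and>
          (\<forall>a\<in>A. \<forall>b\<in>A. f a b \<in> A) \<and>
          (\<forall>a\<in>A. \<forall>b\<in>A. \<forall>c\<in>A. f (f a b) c = f a (f b c)) \<and>
          (\<forall>a\<in>A. opt_key_size a \<le> W) \<and>
          (\<forall>q<p. length (inp q) \<le> L \<and> set (inp q) \<subseteq> A) \<longrightarrow>
          gather p (result (scan f p) p inp) = prefixes f (gather p inp) \<and>
          (\<forall>q<p. length (result (scan f p) p inp q) = length (inp q)) \<and>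
          real (load (scan f p) p inp) \<le> C2 * real W * real L)"
    using assms(3) unfolding prefix_sums_primitive_def by auto
  obtain K3 C3 where ejoin: "\<And>p. 1 \<le> p \<Longrightarrow> rounds (ejoin p) \<le> K3 \<and>
       (\<forall>inp (L::nat) (W::nat).
          real p powr \<delta> \<le> real L \<and> 1 \<le> W \<and>
          (\<forall>q<p. length (fst (inp q)) + length (snd (inp q)) \<le> L \<and>
                 (\<forall>a\<in>set (fst (inp q)) \<union> set (snd (inp q)). tup_size a \<le> W)) \<longrightarrow>
          (let J = equi_join group_key (gather p (fst \<circ> inp)) (gather p (snd \<circ> inp))
           in mset (gather p (result (ejoin p) p inp)) = mset J \<and>
              real (load (ejoin p) p inp) \<le>
                C3 * real W * (sqrt (real (length J) / real p) + real L)))"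
    using assms(4) unfolding equi_join_primitive_def by auto
  \<comment> \<open>The constants of the primitives are arbitrary reals. Raising them to at least 1
    makes products of bounds monotone.\<close>
  define D1 where "D1 = max 1 C1"
  define D2 where "D2 = max 1 C2"
  define D3 where "D3 = max 1 C3"
  have D: "C1 \<le> D1" "1 \<le> D1" "C2 \<le> D2" "1 \<le> D2" "C3 \<le> D3" "1 \<le> D3"
    by (auto simp: D1_def D2_def D3_def)
  \<comment> \<open>The summands come from sorting, from the scan, from the tuples entering the two
    joins, and from the square-root terms. The factors \<open>2 * D1\<close> account for lists that
    sorting has lengthened.\<close>
  define C where "C = D1 + D2 * (2 * D1) + 2 * (D3 * (2 * D1)) + D3"
  define K where "K = nat \<lceil>1 / \<delta>\<rceil> + K1 + K2 + 2 * K3"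
  have C: "1 \<le> C" "D3 \<le> C"
  proof -
    have "0 \<le> D2 * (2 * D1)" "0 \<le> D3 * (2 * D1)" using D by auto
    then show "1 \<le> C" "D3 \<le> C" using D unfolding C_def by linarith+
  qed
  have bound: "rounds (lsh_join srt scan ejoin \<delta> p \<kappa> t d r) \<le> K \<and>
    real (load (lsh_join srt scan ejoin \<delta> p \<kappa> t d r) p (join_input \<kappa> t k inp \<omega>)) \<le>
      real (nat \<lceil>real p powr \<delta>\<rceil> * length (hash_slots \<kappa> t)) +
      C * real (\<kappa> + 5) * (real L +
        sqrt (real (active_collisions t k (set (gather p inp)) \<omega> R_side S_side) / real p) +
        sqrt (real (active_collisions t k (set (gather p inp)) \<omega> S_side R_side) / real p))"
    if p: "1 \<le> p" and L: "real p powr \<delta> \<le> real L" and dist: "distinct (gather p inp)"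
      and len: "\<forall>q<p. length (inp q) * (\<Sum>i\<le>\<kappa>. t i) \<le> L"
    for p L \<kappa> :: nat and t :: "nat \<Rightarrow> nat" and d :: "'u \<Rightarrow> 'u \<Rightarrow> real" and r :: real
      and inp :: "nat \<Rightarrow> (side \<times> 'u) list" and k :: "side \<Rightarrow> 'u \<Rightarrow> nat"
      and \<omega> :: "nat \<times> nat \<Rightarrow> nat \<Rightarrow> 'u \<Rightarrow> real"
  proof
    show "rounds (lsh_join srt scan ejoin \<delta> p \<kappa> t d r) \<le> K"
      using srt[OF p] scan[OF p, of last_some] ejoin[OF p] by (simp add: lsh_join_def K_def)
  next
    define f where "f = nat \<lceil>real p powr \<delta>\<rceil>"
    define W where "W = \<kappa> + 5"
    define bc where "bc = (\<lambda>q::nat. if q = 0 then encode_hashes \<kappa> t \<omega> else [])"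
    define pts where "pts q = map (\<lambda>(s, x). (s, x, k s x)) (inp q)" for q
    define x1 where "x1 = result (broadcast p f (nat \<lceil>1 / \<delta>\<rceil>)) p bc"
    define x2 where "x2 q = gen_tuples \<kappa> t (x1 q, pts q)" for q
    define x3 where "x3 = result (srt p) p x2"
    define x4 where "x4 q = map active_key (x3 q)" for q
    define x5 where "x5 = result (scan last_some p) p x4"
    define x6 where "x6 q = discard (x5 q, x3 q)" for q
    define x7 where "x7 q = (select R_side {Active} (x6 q), select S_side {Active, Passive} (x6 q))" for q
    define x8 where "x8 q = (select R_side {Passive} (x6 q), select S_side {Active} (x6 q))" for q
    \<comment> \<open>Sorting may leave up to \<open>C1 * L\<close> tuples on one processor, so the
      scan and the joins are run with this larger bound. Since \<open>D1 * L\<close> is at least 1,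
      rounding it up loses at most a factor 2.\<close>
    define L1 where "L1 = nat \<lceil>D1 * real L\<rceil>"
    have inp_eq: "join_input \<kappa> t k inp \<omega> = (\<lambda>q. (bc q, pts q))"
      by (auto simp: join_input_def bc_def pts_def)
    have load: "load (lsh_join srt scan ejoin \<delta> p \<kappa> t d r) p (join_input \<kappa> t k inp \<omega>) \<le>
       load (broadcast p f (nat \<lceil>1 / \<delta>\<rceil>)) p bc + (0 + (load (srt p) p x2 + (0 +
         (load (scan last_some p) p x4 + (0 + (0 + (load (ejoin p) p x7 + (0 + (load (ejoin p) p x8 + 0)))))))))"
      unfolding lsh_join_def inp_eq f_def[symmetric]
      by (intro load_seq_comp_le)
        (simp_all add: o_def x1_def x2_def[abs_def] x3_def x4_def[abs_def] x5_def x6_def[abs_def]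
          x7_def[abs_def] x8_def[abs_def])

    have p1: "1 \<le> real p powr \<delta>"
      using p \<delta> by (simp add: ge_one_powr_ge_zero)
    have f: "1 \<le> f" using p1 unfolding f_def by linarith
    have bcq: "bc q = []" if "0 < q" for q using that by (simp add: bc_def)
    have load1: "load (broadcast p f (nat \<lceil>1 / \<delta>\<rceil>)) p bc \<le> f * length (hash_slots \<kappa> t)"
      using load_broadcast[of p bc f "nat \<lceil>1 / \<delta>\<rceil>"] bcq f by (simp add: bc_def encode_hashes_def)
    have x1: "x1 q = encode_hashes \<kappa> t \<omega>" if "q < p" for q
      using result_broadcast[of p bc f "nat \<lceil>1 / \<delta>\<rceil>" q] bcq f that broadcast_depth[OF \<delta> p]
      by (simp add: x1_def f_def) (simp add: bc_def)
    define g where "g = gen_tuples \<kappa> t (encode_hashes \<kappa> t \<omega>, map (\<lambda>(s, x). (s, x, k s x)) (gather p inp))"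
    have "gather p x2 = gather p (\<lambda>q. gen_tuples \<kappa> t (encode_hashes \<kappa> t \<omega>, pts q))"
      by (auto simp: gather_def x2_def x1 intro!: arg_cong[where f = concat])
    also have "\<dots> = g"
      unfolding gather_gen_tuples g_def
      by (simp add: gather_def pts_def map_concat o_def)
    finally have g: "gather p x2 = g" .
    have x2: "length (x2 q) \<le> L \<and> (\<forall>a\<in>set (x2 q). tup_size a \<le> W)" if "q < p" for q
      using length_gen_tuples[of \<kappa> t \<omega> "pts q"] len that
      by (auto simp: x2_def x1 pts_def W_def tup_size_gen_tuples intro: order_trans)
    have W: "1 \<le> W" by (simp add: W_def)
    have s3: "mset (gather p x3) = mset g" "\<And>q. q < p \<Longrightarrow> real (length (x3 q)) \<le> C1 * real L"
      and load2: "real (load (srt p) p x2) \<le> C1 * real W * real L"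
      using srt[OF p, THEN conjunct2, rule_format, of L W x2] L x2 W unfolding x3_def g by auto
    have L0: "1 \<le> real L" using p1 L by simp
    have L1: "real L \<le> real L1" "real L1 \<le> 2 * D1 * real L"
    proof -
      have "1 * real L \<le> D1 * real L" "1 * 1 \<le> D1 * real L" using D L0 by (intro mult_mono; simp)+
      then show "real L \<le> real L1" "real L1 \<le> 2 * D1 * real L" unfolding L1_def by linarith+
    qed
    have x3: "length (x3 q) \<le> L1 \<and> (\<forall>a\<in>set (x3 q). a \<in> set g)" if "q < p" for q
    proof
      have "C1 * real L \<le> D1 * real L" using D by (intro mult_right_mono) auto
      then show "length (x3 q) \<le> L1"
        using s3(2)[OF that] unfolding L1_def by linarith
      have "set (x3 q) \<subseteq> set (gather p x3)" using that by (auto simp: set_gather)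
      also have "\<dots> = set g" using s3(1) by (rule mset_eq_setD)
      finally show "\<forall>a\<in>set (x3 q). a \<in> set g" by blast
    qed
    have gW: "tup_size a \<le> W" if "a \<in> set g" for a
      using that tup_size_gen_tuples unfolding g_def W_def by blast
    \<comment> \<open>\<open>last_some\<close> returns one of its arguments, so keys of bounded size
      are closed under it and partial results do not grow during the scan.\<close>
    define A where "A = {m. opt_key_size m \<le> W}"
    have "length (x4 q) \<le> L1 \<and> set (x4 q) \<subseteq> A" if "q < p" for q
    proof -
      have "opt_key_size (active_key a) \<le> W" if "a \<in> set g" for a
        using gW[OF that] W by (auto simp: active_key_def opt_key_size_def tup_size_def)
      with x3[OF that] show ?thesis by (auto simp: x4_def A_def)
    qed
    moreover have "\<forall>a\<in>A. \<forall>b\<in>A. last_some a b \<in> A"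
      by (auto simp: last_some_def A_def split: option.splits)
    moreover have "\<forall>a\<in>A. \<forall>b\<in>A. \<forall>c\<in>A. last_some (last_some a b) c = last_some a (last_some b c)"
      by (auto simp: last_some_def split: option.splits)
    moreover have "real p powr \<delta> \<le> real L1" using L L1 by linarith
    ultimately have load3: "real (load (scan last_some p) p x4) \<le> C2 * real W * real L1"
      using scan[OF p, THEN conjunct2, rule_format, of L1 W A last_some x4] W
      by (auto simp: A_def)

    have x6q: "mset (x6 q) \<subseteq># mset (x3 q)" for q
      by (simp add: x6_def mset_discard)
    have x6: "mset (gather p x6) \<subseteq># mset g"
      using mset_gather_mono[of p x6 x3] x6q s3(1) by simp
    \<comment> \<open>One estimate for both joins: \<open>s\<close> is the side restricted to active
      tuples, and the other side may carry any set of statuses.\<close>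
    have join: "real (load (ejoin p) p y) \<le>
         D3 * real W * (sqrt (real (active_collisions t k (set (gather p inp)) \<omega> s s') / real p) + real L1)"
      if y: "\<And>q. y q = (select R_side A (x6 q), select S_side B (x6 q))"
        and s: "(s, s') = (R_side, S_side) \<and> A = {Active} \<or> (s, s') = (S_side, R_side) \<and> B = {Active}" for y s s' A B
    proof -
      have y1: "gather p (fst \<circ> y) = select R_side A (gather p x6)"
        "gather p (snd \<circ> y) = select S_side B (gather p x6)"
        by (simp_all add: y o_def select_gather)
      have "length (fst (y q)) + length (snd (y q)) \<le> L1 \<and>
          (\<forall>a\<in>set (fst (y q)) \<union> set (snd (y q)). tup_size a \<le> W)" if "q < p" for q
      proof -
        have "length (select R_side A (x6 q)) + length (select S_side B (x6 q)) \<le> length (x6 q)"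
          by (rule length_select_select) simp
        moreover have "length (x6 q) \<le> length (x3 q)" "set (x6 q) \<subseteq> set (x3 q)"
          using size_mset_mono[OF x6q[of q]] set_mset_mono[OF x6q[of q]] by auto
        ultimately show ?thesis
          using x3[OF that] gW by (auto simp: y select_def)
      qed
      then have "real (load (ejoin p) p y) \<le> C3 * real W *
          (sqrt (real (length (equi_join group_key (gather p (fst \<circ> y)) (gather p (snd \<circ> y)))) / real p)
            + real L1)"
        using ejoin[OF p, THEN conjunct2, rule_format, of L1 W y] L L1 W by (auto simp: Let_def)
      moreover have "length (equi_join group_key (gather p (fst \<circ> y)) (gather p (snd \<circ> y)))
          \<le> active_collisions t k (set (gather p inp)) \<omega> s s'"
      proof -
        have "length (equi_join group_key (gather p (fst \<circ> y)) (gather p (snd \<circ> y)))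
          \<le> length (equi_join group_key (select R_side A g) (select S_side B g))"
          unfolding y1 by (intro length_equi_join_mono mset_select_mono x6)
        also have "\<dots> \<le> active_collisions t k (set (gather p inp)) \<omega> s s'"
          using s
        proof
          assume "(s, s') = (R_side, S_side) \<and> A = {Active}"
          then show ?thesis
            using length_equi_join_active[where s=s and s'=s' and A=B and k=k and t=t and \<kappa>=\<kappa> and \<omega>=\<omega>, OF dist] by (simp add: g_def)
        next
          assume "(s, s') = (S_side, R_side) \<and> B = {Active}"
          then show ?thesis
            using length_equi_join_active[where s=s and s'=s' and A=A and k=k and t=t and \<kappa>=\<kappa> and \<omega>=\<omega>, OF dist]
            by (subst length_equi_join_commute) (simp add: g_def)
        qed
        finally show ?thesis .
      qed
      then have "C3 * real W *
          (sqrt (real (length (equi_join group_key (gather p (fst \<circ> y)) (gather p (snd \<circ> y)))) / real p)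
            + real L1) \<le> D3 * real W * (sqrt (real (active_collisions t k (set (gather p inp)) \<omega> s s') / real p) + real L1)"
        using D by (intro mult_mono add_mono real_sqrt_le_mono divide_right_mono order_refl) auto
      ultimately show ?thesis by linarith
    qed
    show "real (load (lsh_join srt scan ejoin \<delta> p \<kappa> t d r) p (join_input \<kappa> t k inp \<omega>)) \<le>
      real (nat \<lceil>real p powr \<delta>\<rceil> * length (hash_slots \<kappa> t)) +
      C * real (\<kappa> + 5) * (real L +
        sqrt (real (active_collisions t k (set (gather p inp)) \<omega> R_side S_side) / real p) +
        sqrt (real (active_collisions t k (set (gather p inp)) \<omega> S_side R_side) / real p))"
    proof -
      define s1 where "s1 = sqrt (real (active_collisions t k (set (gather p inp)) \<omega> R_side S_side) / real p)"
      define s2 where "s2 = sqrt (real (active_collisions t k (set (gather p inp)) \<omega> S_side R_side) / real p)"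
      have pos: "0 \<le> s1" "0 \<le> s2" "0 \<le> real W * real L" "0 \<le> real W"
        by (auto simp: s1_def s2_def)
      have "C1 * real W * real L \<le> D1 * (real W * real L)"
        using D pos by (simp add: mult.assoc mult_right_mono)
      moreover have "C2 * real W * real L1 \<le> D2 * real W * (2 * D1 * real L)"
        using D L1 by (intro mult_mono) auto
      moreover have "real (load (ejoin p) p x7) \<le> D3 * real W * (s1 + 2 * D1 * real L)"
      proof -
        have "real (load (ejoin p) p x7) \<le> D3 * real W * (s1 + real L1)"
          using join[OF x7_def, of R_side S_side] by (simp add: s1_def)
        also have "\<dots> \<le> D3 * real W * (s1 + 2 * D1 * real L)"
          using L1 D pos by (intro mult_left_mono add_left_mono) auto
        finally show ?thesis .
      qed
      moreover have "real (load (ejoin p) p x8) \<le> D3 * real W * (s2 + 2 * D1 * real L)"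
      proof -
        have "real (load (ejoin p) p x8) \<le> D3 * real W * (s2 + real L1)"
          using join[OF x8_def, of S_side R_side] by (simp add: s2_def)
        also have "\<dots> \<le> D3 * real W * (s2 + 2 * D1 * real L)"
          using L1 D pos by (intro mult_left_mono add_left_mono) auto
        finally show ?thesis .
      qed
      ultimately have "real (load (lsh_join srt scan ejoin \<delta> p \<kappa> t d r) p (join_input \<kappa> t k inp \<omega>)) \<le>
          real (f * length (hash_slots \<kappa> t)) + D1 * (real W * real L) + D2 * real W * (2 * D1 * real L)
          + D3 * real W * (s1 + 2 * D1 * real L) + D3 * real W * (s2 + 2 * D1 * real L)"
        using load load1 load2 load3 by linarith
      also have "\<dots> = real (f * length (hash_slots \<kappa> t)) +
          ((C - D3) * (real W * real L) + D3 * (real W * (s1 + s2)))"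
        by (simp add: C_def algebra_simps)
      also have "\<dots> \<le> real (f * length (hash_slots \<kappa> t)) +
          (C * (real W * real L) + C * (real W * (s1 + s2)))"
        using C D pos by (intro add_left_mono add_mono mult_right_mono) auto
      also have "\<dots> = real (f * length (hash_slots \<kappa> t)) + C * real W * (real L + s1 + s2)"
        by (simp add: algebra_simps)
      finally show ?thesis
        unfolding f_def W_def s1_def s2_def .
    qed
  qed
  show thesis
    using C(1) by (rule that) (rule bound)
qed

section \<open>Expected number of collisions\<close>

lemma coll_sets:
  fixes H :: "('u \<Rightarrow> real) measure"
  assumes "\<forall>x\<in>U. (\<lambda>h. h x) \<in> borel_measurable H" "x \<in> U" "y \<in> U"
  shows "{h \<in> space H. h x = h y} \<in> sets H"
proof -
  have "(\<lambda>h. h x) \<in> borel_measurable H" "(\<lambda>h. h y) \<in> borel_measurable H"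
    using assms by auto
  then show ?thesis by (rule borel_measurable_eq)
qed

text \<open>Concatenations agree exactly when all components agree, so the event is a box in the
  product space. This yields its measurability and, by independence, its probability
  \<open>coll H x y ^ i\<close>.\<close>

lemma level_coll_event:
  "{hs \<in> space (hash_concat H i). hash_apply i hs x = hash_apply i hs y}
     = Pi\<^sub>E {..<i} (\<lambda>_. {h \<in> space H. h x = h y})"
proof -
  have "hash_apply i hs x = hash_apply i hs y \<longleftrightarrow> (\<forall>l\<in>{..<i}. hs l x = hs l y)" for hs
    by (auto simp: hash_apply_def)
  then show ?thesis
    unfolding hash_concat_def space_PiM by (simp only:) (use PiE_iff in blast)
qed

lemma level_coll_eq:
  assumes "prob_space H" "\<forall>x\<in>U. (\<lambda>h. h x) \<in> borel_measurable H" "x \<in> U" "y \<in> U"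
  shows "level_coll H i x y = coll H x y ^ i"
proof -
  interpret prob_space H by fact
  interpret P: product_prob_space "\<lambda>_. H" "{..<i}" ..
  interpret P: finite_product_prob_space "\<lambda>_. H" "{..<i}" by standard auto
  show ?thesis
    unfolding level_coll_def level_coll_event unfolding hash_concat_def
    using P.finite_measure_PiM_emb[of "\<lambda>_. {h \<in> space H. h x = h y}"] coll_sets[OF assms(2-4)]
    by (simp add: coll_def)
qed

lemma prob_space_hash_concat: "prob_space H \<Longrightarrow> prob_space (hash_concat H i)"
  unfolding hash_concat_def by (intro prob_space_PiM)

text \<open>The coordinate \<open>(i, j)\<close> of the sample is distributed as
  \<open>hash_concat H i\<close>, so the event is the preimage of the one that defines
  \<open>level_coll\<close>.\<close>

lemma hash_sample_collision:
  fixes t :: "nat \<Rightarrow> nat"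
  assumes H: "prob_space H" "\<forall>x\<in>U. (\<lambda>h. h x) \<in> borel_measurable H" "x \<in> U" "y \<in> U"
    and ij: "i \<le> \<kappa>" "j < t i"
  defines "M \<equiv> hash_sample H \<kappa> t"
  defines "E \<equiv> {\<omega> \<in> space M. hash_apply i (\<omega> (i, j)) x = hash_apply i (\<omega> (i, j)) y}"
  shows "E \<in> sets M" "measure M E = level_coll H i x y"
proof -
  let ?I = "SIGMA i:{..\<kappa>}. {..<t i}"
  let ?N = "\<lambda>(i, j::nat). hash_concat H i"
  let ?B = "{hs \<in> space (hash_concat H i). hash_apply i hs x = hash_apply i hs y}"
  have M: "M = Pi\<^sub>M ?I ?N" by (simp add: M_def hash_sample_def)
  have "(\<lambda>\<omega>. \<omega> (i, j)) \<in> M \<rightarrow>\<^sub>M ?N (i, j)"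
    unfolding M using ij by (intro measurable_component_singleton) auto
  then have comp: "(\<lambda>\<omega>. \<omega> (i, j)) \<in> M \<rightarrow>\<^sub>M hash_concat H i" by simp
  have B: "?B \<in> sets (hash_concat H i)"
    unfolding level_coll_event unfolding hash_concat_def
    by (intro sets_PiM_I_finite) (auto intro: coll_sets[OF H(2-4)])
  have E: "E = (\<lambda>\<omega>. \<omega> (i, j)) -` ?B \<inter> space M"
    using measurable_space[OF comp] by (auto simp: E_def)
  show "E \<in> sets M"
    unfolding E using comp B by (rule measurable_sets)
  have "distr M (?N (i, j)) (\<lambda>\<omega>. \<omega> (i, j)) = ?N (i, j)"
    unfolding M using ij by (intro distr_PiM_component) (auto intro: prob_space_hash_concat[OF H(1)])
  then have "measure (distr M (hash_concat H i) (\<lambda>\<omega>. \<omega> (i, j))) ?B = level_coll H i x y"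
    by (simp add: level_coll_def)
  then show "measure M E = level_coll H i x y"
    unfolding E using measure_distr[OF comp B] by simp
qed

lemma prob_space_hash_sample: "prob_space H \<Longrightarrow> prob_space (hash_sample H \<kappa> t)"
  unfolding hash_sample_def by (intro prob_space_PiM) (auto intro: prob_space_hash_concat)

text \<open>Linearity of expectation over indicators of collisions. The bound
  \<open>k s x \<le> \<kappa>\<close> ensures that the coordinates consulted belong to the
  sample.\<close>

lemma active_collisions_measurable_expectation:
  fixes Z :: "(side \<times> 'u) set" and t :: "nat \<Rightarrow> nat"
  assumes H: "prob_space H" "\<forall>x\<in>U. (\<lambda>h. h x) \<in> borel_measurable H"
    and Z: "finite Z" "snd ` Z \<subseteq> U" "\<And>x. (s, x) \<in> Z \<Longrightarrow> k s x \<le> \<kappa>"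
  defines "M \<equiv> hash_sample H \<kappa> t"
  shows "integrable M (\<lambda>\<omega>. real (active_collisions t k Z \<omega> s s'))" (is ?int)
    and "integral\<^sup>L M (\<lambda>\<omega>. real (active_collisions t k Z \<omega> s s')) =
      (\<Sum>x | (s, x) \<in> Z. real (t (k s x)) * (\<Sum>y | (s', y) \<in> Z. level_coll H (k s x) x y))" (is ?val)
proof -
  interpret M: prob_space M unfolding M_def by (rule prob_space_hash_sample[OF H(1)])
  define E where "E i j x y = {\<omega> \<in> space M. hash_apply i (\<omega> (i, j)) x = hash_apply i (\<omega> (i, j)) y}"
    for i j and x y :: 'u
  have E: "E (k s x) j x y \<in> sets M \<and> measure M (E (k s x) j x y) = level_coll H (k s x) x y"
    if "(s, x) \<in> Z" "(s', y) \<in> Z" "j < t (k s x)" for x y j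
  proof -
    have "x \<in> U" "y \<in> U"
      using that(1,2) Z(2) by force+
    moreover have "k s x \<le> \<kappa>"
      using that(1) Z(3) by simp
    ultimately show ?thesis
      using hash_sample_collision[OF H, of x y "k s x" \<kappa> j t] that by (simp add: E_def M_def)
  qed
  have *: "real (active_collisions t k Z \<omega> s s') =
      (\<Sum>x | (s, x) \<in> Z. \<Sum>j<t (k s x). \<Sum>y | (s', y) \<in> Z. indicator (E (k s x) j x y) \<omega>)"
    if "\<omega> \<in> space M" for \<omega>
    using that unfolding active_collisions_def E_def of_nat_sum
    by (intro sum.cong refl) (simp add: indicator_def)
  have "has_bochner_integral M (\<lambda>\<omega>. \<Sum>x | (s, x) \<in> Z. \<Sum>j<t (k s x). \<Sum>y | (s', y) \<in> Z.
           indicator (E (k s x) j x y) \<omega>)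
         (\<Sum>x | (s, x) \<in> Z. \<Sum>j<t (k s x). \<Sum>y | (s', y) \<in> Z. level_coll H (k s x) x y)"
  proof (intro has_bochner_integral_sum)
    fix x j y assume "x \<in> {x. (s, x) \<in> Z}" "j \<in> {..<t (k s x)}" "y \<in> {y. (s', y) \<in> Z}"
    with E have "E (k s x) j x y \<in> sets M" "measure M (E (k s x) j x y) = level_coll H (k s x) x y"
      by auto
    then show "has_bochner_integral M (indicator (E (k s x) j x y)) (level_coll H (k s x) x y)"
      using has_bochner_integral_real_indicator[of "E (k s x) j x y" M]
      by (simp add: M.emeasure_eq_measure)
  qed
  then have "has_bochner_integral M (\<lambda>\<omega>. real (active_collisions t k Z \<omega> s s'))
         (\<Sum>x | (s, x) \<in> Z. \<Sum>j<t (k s x). \<Sum>y | (s', y) \<in> Z. level_coll H (k s x) x y)"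
    by (rule iffD2[OF has_bochner_integral_cong[OF refl _ refl], rotated]) (rule *)
  moreover have "(\<Sum>x | (s, x) \<in> Z. \<Sum>j<t (k s x). \<Sum>y | (s', y) \<in> Z. level_coll H (k s x) x y) =
      (\<Sum>x | (s, x) \<in> Z. real (t (k s x)) * (\<Sum>y | (s', y) \<in> Z. level_coll H (k s x) x y))"
    by simp
  ultimately show ?int ?val
    unfolding has_bochner_integral_iff by metis+
qed

section \<open>Density levels and the cost of a point\<close>

text \<open>Take the first threshold \<open>n * p2 ^ i\<close> that is at most \<open>N\<close>. It
  is not the one with index 0, because \<open>N < n\<close>, and its predecessor is the required
  level.\<close>

lemma ex_dense:
  assumes "N < n"
  shows "\<exists>i\<le>\<kappa>. dense n p2 \<kappa> i N"
proof (cases "real N < real n * p2 ^ \<kappa>")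
  case True
  then show ?thesis by (auto simp: dense_def)
next
  case False
  define i where "i = (LEAST i. real n * p2 ^ i \<le> real N)"
  have i: "real n * p2 ^ i \<le> real N" "i \<le> \<kappa>"
    unfolding i_def using False by (auto intro: LeastI[of _ \<kappa>] Least_le)
  with assms have "0 < i" by (cases i) auto
  then obtain j where j: "i = Suc j" using gr0_implies_Suc by blast
  have "\<not> real n * p2 ^ j \<le> real N"
    using not_less_Least[of j "\<lambda>i. real n * p2 ^ i \<le> real N"] j unfolding i_def by simp
  with i j have "dense n p2 \<kappa> j N" by (simp add: dense_def)
  then show ?thesis using i j by (intro exI[of _ j]) auto
qed

lemma card_pairs:
  assumes "finite X" "finite Y"
  shows "card {(x, y) \<in> X \<times> Y. P x y} = (\<Sum>x\<in>X. card {y \<in> Y. P x y})"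
proof -
  have "{(x, y) \<in> X \<times> Y. P x y} = (SIGMA x:X. {y \<in> Y. P x y})" by auto
  then show ?thesis using assms by simp
qed

lemma level_cost_bound:
  assumes lsh: "lsh_family U d r (c * r) p1 p2 H" and thr: "threshold_prob U d r p1 H"
    and lc: "\<And>i x y. x \<in> U \<Longrightarrow> y \<in> U \<Longrightarrow> level_coll H i x y = coll H x y ^ i"
    and p1: "0 < p1" "p1 < 1" and p2: "lo \<le> p2" "0 < lo"
    and xU: "x \<in> U" "Y \<subseteq> U" and Y: "finite Y" "card Y \<le> n"
    and dense: "dense n p2 \<kappa> i (near_count d r Y x)"
  shows "(1 / p1) ^ i * (\<Sum>y\<in>Y. level_coll H i x y) \<le>
     (1 + 1 / lo) * ((1 / p1) ^ i * real (near_count d r Y x)) +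
     real (card {y \<in> Y. r < d x y \<and> d x y \<le> c * r}) + real n * (p2 / p1) ^ \<kappa>"
proof -
  interpret H: prob_space H using lsh by (simp add: lsh_family_def)
  have p2': "0 < p2" using p2 by simp
  let ?N = "real (near_count d r Y x)"
  let ?C = "real (card {y \<in> Y. r < d x y \<and> d x y \<le> c * r})"
  \<comment> \<open>The middle coefficient \<open>p1 ^ i\<close> is what cancels the number \<open>(1 / p1) ^ i\<close> of repetitions for
    \<open>c\<close>-near pairs; it comes from the threshold convention.\<close>
  have *: "level_coll H i x y \<le> (if d x y \<le> r then 1 else 0) +
      p1 ^ i * (if r < d x y \<and> d x y \<le> c * r then 1 else 0) + p2 ^ i" if "y \<in> Y" for y
  proof -
    have y: "y \<in> U" using that xU by auto
    have c0: "0 \<le> coll H x y" "coll H x y \<le> 1" by (auto simp: coll_def)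
    consider "d x y \<le> r" | "r < d x y" "d x y \<le> c * r" | "c * r < d x y" by linarith
    then show ?thesis
    proof cases
      case 1
      have "coll H x y ^ i \<le> 1" using c0 by (rule power_le_one)
      with 1 p1 p2' show ?thesis
        by (auto simp: lc[OF xU(1) y] intro!: add_increasing2)
    next
      case 2
      then have "coll H x y \<le> p1" using thr xU y by (auto simp: threshold_prob_def)
      then have "coll H x y ^ i \<le> p1 ^ i" using c0 by (intro power_mono)
      with 2 p1 p2' show ?thesis
        by (auto simp: lc[OF xU(1) y] intro!: add_increasing2)
    next
      case 3
      then have "coll H x y \<le> p2" using lsh xU y by (auto simp: lsh_family_def)
      then have "coll H x y ^ i \<le> p2 ^ i" using c0 by (intro power_mono)
      with p1 show ?thesis
        by (auto simp: lc[OF xU(1) y] intro!: add_increasing)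
    qed
  qed
  have "(\<Sum>y\<in>Y. level_coll H i x y) \<le> (\<Sum>y\<in>Y. (if d x y \<le> r then 1 else 0) +
      p1 ^ i * (if r < d x y \<and> d x y \<le> c * r then 1 else 0) + p2 ^ i)"
    by (intro sum_mono *)
  \<comment> \<open>The far term \<open>p2 ^ i\<close> is charged to every point of
    \<open>Y\<close>, near or far, so that no separate count of far points is needed.\<close>
  also have "\<dots> = ?N + p1 ^ i * ?C + real (card Y) * p2 ^ i"
    using Y by (simp add: sum.distrib sum_distrib_left[symmetric] near_count_def sum.If_cases Int_def)
  also have "\<dots> \<le> ?N + p1 ^ i * ?C + real n * p2 ^ i"
    using Y p2' by (intro add_left_mono mult_right_mono) auto
  finally have "(1 / p1) ^ i * (\<Sum>y\<in>Y. level_coll H i x y) \<le>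
      (1 / p1) ^ i * (?N + p1 ^ i * ?C + real n * p2 ^ i)"
    using p1 by (intro mult_left_mono) auto
  also have "\<dots> = (1 / p1) ^ i * ?N + ?C + (1 / p1) ^ i * (real n * p2 ^ i)"
    using p1 by (simp add: field_simps)
  \<comment> \<open>Below \<kappa>, density bounds the near count from below by the threshold with
    exponent \<open>i + 1\<close>. Returning to exponent \<open>i\<close> costs
    \<open>1 / p2\<close>, at most \<open>1 / lo\<close>. At \<kappa> there is no lower bound on the
    near count, so the term stays.\<close>
  also have "(1 / p1) ^ i * (real n * p2 ^ i) \<le> 1 / lo * ((1 / p1) ^ i * ?N) + real n * (p2 / p1) ^ \<kappa>"
  proof (cases "i = \<kappa>")
    case True
    then have "(1 / p1) ^ i * (real n * p2 ^ i) = real n * (p2 / p1) ^ \<kappa>"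
      by (simp add: power_divide)
    moreover have "0 \<le> 1 / lo * ((1 / p1) ^ i * ?N)" using p1 p2 by simp
    ultimately show ?thesis by linarith
  next
    case False
    with dense have "real n * p2 ^ i * p2 \<le> ?N" by (simp add: dense_def mult_ac)
    moreover have "real n * p2 ^ i * lo \<le> real n * p2 ^ i * p2"
      using p2 p2' by (intro mult_left_mono) auto
    ultimately have "real n * p2 ^ i \<le> 1 / lo * ?N" using p2 by (simp add: field_simps)
    then have "(1 / p1) ^ i * (real n * p2 ^ i) \<le> (1 / p1) ^ i * (1 / lo * ?N)"
      using p1 by (intro mult_left_mono) auto
    moreover have "0 \<le> real n * (p2 / p1) ^ \<kappa>" using p1 p2' by simp
    ultimately show ?thesis by (simp add: mult_ac)
  qed
  finally show ?thesis by (simp add: algebra_simps)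
qed

lemma total_level_cost_bound:
  assumes lsh: "lsh_family U d r (c * r) p1 p2 H" and thr: "threshold_prob U d r p1 H"
    and lc: "\<And>i x y. x \<in> U \<Longrightarrow> y \<in> U \<Longrightarrow> level_coll H i x y = coll H x y ^ i"
    and p1: "0 < p1" "p1 < 1" and p2: "lo \<le> p2" "0 < lo"
    and X: "finite X" "X \<subseteq> U" and Y: "finite Y" "Y \<subseteq> U" and n: "n = card X + card Y"
    and k: "\<forall>x\<in>X. optimal_level H p1 \<kappa> Y x (k x)"
  shows "(\<Sum>x\<in>X. (1 / p1) ^ k x * (\<Sum>y\<in>Y. level_coll H (k x) x y)) \<le>
     real n * (1 / p1) ^ \<kappa> +
     (1 + 1 / lo) * (\<Sum>i\<le>\<kappa>. (1 / p1) ^ i *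
        real (card {(x, y) \<in> X \<times> Y. d x y \<le> r \<and> dense n p2 \<kappa> i (near_count d r Y x)})) +
     real (card {(x, y) \<in> X \<times> Y. r < d x y \<and> d x y \<le> c * r}) +
     real n * (real n * (p2 / p1) ^ \<kappa>)"
proof -
  let ?N = "\<lambda>x. near_count d r Y x"
  have "\<exists>i\<le>\<kappa>. dense n p2 \<kappa> i (?N x)" if "x \<in> X" for x
  proof (rule ex_dense)
    have "?N x \<le> card Y" using Y by (auto simp: near_count_def intro: card_mono)
    moreover have "0 < card X" using that X by (auto simp: card_gt_0_iff)
    ultimately show "?N x < n" using n by simp
  qed
  then obtain i where i: "\<And>x. x \<in> X \<Longrightarrow> i x \<le> \<kappa> \<and> dense n p2 \<kappa> (i x) (?N x)"
    by metis
  have lc0: "0 \<le> level_coll H j x y" for j x y by (simp add: level_coll_def)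
  have "(\<Sum>x\<in>X. (1 / p1) ^ k x * (\<Sum>y\<in>Y. level_coll H (k x) x y)) \<le>
    (\<Sum>x\<in>X. (1 / p1) ^ \<kappa> + ((1 + 1 / lo) * (\<Sum>j\<le>\<kappa>. if dense n p2 \<kappa> j (?N x) then (1 / p1) ^ j * real (?N x) else 0)
      + real (card {y \<in> Y. r < d x y \<and> d x y \<le> c * r}) + real n * (p2 / p1) ^ \<kappa>))"
  proof (intro sum_mono)
    fix x assume x: "x \<in> X"
    have "(1 / p1) ^ k x * (\<Sum>y\<in>Y. level_coll H (k x) x y) \<le> (1 / p1) ^ k x * (1 + (\<Sum>y\<in>Y. level_coll H (k x) x y))"
      using p1 by (intro mult_left_mono) auto
    \<comment> \<open>Minimality of \<open>k x\<close> applies because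
      \<open>i x \<le> \<kappa>\<close>. The summand 1 in the cost survives as
      \<open>(1 / p1) ^ i x\<close> and gives the first term of the bound.\<close>
    also have "\<dots> \<le> (1 / p1) ^ i x * (1 + (\<Sum>y\<in>Y. level_coll H (i x) x y))"
      using k x i by (auto simp: optimal_level_def is_arg_min_def not_less)
    also have "\<dots> = (1 / p1) ^ i x + (1 / p1) ^ i x * (\<Sum>y\<in>Y. level_coll H (i x) x y)"
      by (simp add: algebra_simps)
    finally have "(1 / p1) ^ k x * (\<Sum>y\<in>Y. level_coll H (k x) x y) \<le>
        (1 / p1) ^ i x + (1 / p1) ^ i x * (\<Sum>y\<in>Y. level_coll H (i x) x y)" .
    moreover have "(1 / p1) ^ i x \<le> (1 / p1) ^ \<kappa>"
      using i[OF x] p1 by (intro power_increasing) auto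
    moreover have "(1 / p1) ^ i x * (\<Sum>y\<in>Y. level_coll H (i x) x y) \<le>
        (1 + 1 / lo) * ((1 / p1) ^ i x * real (?N x)) +
        real (card {y \<in> Y. r < d x y \<and> d x y \<le> c * r}) + real n * (p2 / p1) ^ \<kappa>"
      using x X Y n i[OF x] by (intro level_cost_bound[OF lsh thr lc p1 p2]) auto
    \<comment> \<open>The chosen level is replaced by the sum over all levels at which
      \<open>x\<close> is dense. The terms are nonnegative, and without the choice function the sums
      over points and levels can be exchanged.\<close>
    moreover have "(1 + 1 / lo) * ((1 / p1) ^ i x * real (?N x)) \<le>
        (1 + 1 / lo) * (\<Sum>j\<le>\<kappa>. if dense n p2 \<kappa> j (?N x) then (1 / p1) ^ j * real (?N x) else 0)"
      using p2 member_le_sum[of "i x" "{..\<kappa>}" "\<lambda>j. if dense n p2 \<kappa> j (?N x) then (1 / p1) ^ j * real (?N x) else 0"]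
        i[OF x] p1 by (intro mult_left_mono) auto
    ultimately show "(1 / p1) ^ k x * (\<Sum>y\<in>Y. level_coll H (k x) x y) \<le>
      (1 / p1) ^ \<kappa> + ((1 + 1 / lo) * (\<Sum>j\<le>\<kappa>. if dense n p2 \<kappa> j (?N x) then (1 / p1) ^ j * real (?N x) else 0)
      + real (card {y \<in> Y. r < d x y \<and> d x y \<le> c * r}) + real n * (p2 / p1) ^ \<kappa>)"
      by linarith
  qed
  also have "\<dots> = real (card X) * (1 / p1) ^ \<kappa> + (1 + 1 / lo) *
      (\<Sum>x\<in>X. \<Sum>j\<le>\<kappa>. if dense n p2 \<kappa> j (?N x) then (1 / p1) ^ j * real (?N x) else 0) +
      (\<Sum>x\<in>X. real (card {y \<in> Y. r < d x y \<and> d x y \<le> c * r})) + real (card X) * (real n * (p2 / p1) ^ \<kappa>)"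
    by (simp add: sum.distrib sum_distrib_left del: power_divide of_nat_sum)
  also have "(\<Sum>x\<in>X. real (card {y \<in> Y. r < d x y \<and> d x y \<le> c * r})) =
      real (card {(x, y) \<in> X \<times> Y. r < d x y \<and> d x y \<le> c * r})"
    by (simp only: card_pairs[OF X(1) Y(1)] of_nat_sum)
  also have "(\<Sum>x\<in>X. \<Sum>j\<le>\<kappa>. if dense n p2 \<kappa> j (?N x) then (1 / p1) ^ j * real (?N x) else 0) =
     (\<Sum>j\<le>\<kappa>. (1 / p1) ^ j * real (card {(x, y) \<in> X \<times> Y. d x y \<le> r \<and> dense n p2 \<kappa> j (?N x)}))"
    (is "?L = ?R")
  proof -
    have "?L = (\<Sum>j\<le>\<kappa>. \<Sum>x\<in>X. if dense n p2 \<kappa> j (?N x) then (1 / p1) ^ j * real (?N x) else 0)"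
      by (rule sum.swap)
    also have "\<dots> = ?R"
      unfolding card_pairs[OF X(1) Y(1)] of_nat_sum sum_distrib_left
      by (intro sum.cong refl) (auto simp: near_count_def)
    finally show ?thesis .
  qed
  also have "real (card X) * (1 / p1) ^ \<kappa> \<le> real n * (1 / p1) ^ \<kappa>"
    using n p1 by (intro mult_right_mono) auto
  also have "real (card X) * (real n * (p2 / p1) ^ \<kappa>) \<le> real n * (real n * (p2 / p1) ^ \<kappa>)"
    using n p1 p2 by (intro mult_right_mono) auto
  finally show ?thesis by simp
qed

section \<open>The choice of \<kappa> and the expected size of the joins\<close>

text \<open>Let \<open>a\<close> be \<kappa> before rounding. From
  \<open>\<rho> * ln p2 = ln p1\<close> and \<open>\<rho> * \<beta> = 1 - \<beta>\<close> both
  powers with exponent \<open>a\<close> are explicit powers of \<open>p\<close>. Rounding up only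
  decreases \<open>p2 ^ \<kappa>\<close> and increases \<open>(1 / p1) ^ \<kappa>\<close> by at most
  \<open>1 / p1\<close>. The logarithmic bound uses that \<open>hi\<close> keeps \<open>p2\<close>
  away from 1; in the constant, 6 is 5 plus 1 for the rounding.\<close>

lemma kappa_bounds:
  fixes p n :: nat
  assumes p1: "0 < lo" "lo \<le> p1" "p1 < 1" and p2: "lo \<le> p2" "p2 \<le> hi" "hi < 1"
    and \<rho>: "\<rho> = ln p1 / ln p2" and p: "1 \<le> p" "p \<le> n"
  defines "\<beta> \<equiv> 1 / (1 + \<rho>)" and "\<kappa> \<equiv> kappa p1 \<rho> p"
  shows "0 < \<beta>" "\<beta> < 1"
    and "(1 / p1) ^ \<kappa> \<le> real p powr (1 - \<beta>) / lo"
    and "p2 ^ \<kappa> \<le> real p powr - \<beta>"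
    and "real (\<kappa> + 5) \<le> (6 + \<bar>1 / ln hi\<bar>) * (1 + ln (real n))"
proof -
  have ln: "ln p1 < 0" "ln p2 < 0" "ln hi < 0" "ln p2 \<le> ln hi" using p1 p2 by auto
  have \<rho>0: "0 < \<rho>" using ln by (simp add: \<rho> divide_neg_neg)
  then show \<beta>: "0 < \<beta>" "\<beta> < 1" by (auto simp: \<beta>_def)
  have lnp: "0 \<le> ln (real p)" "ln (real p) \<le> ln (real n)" using p by auto
  define a where "a = \<rho> / (1 + \<rho>) * log (1 / p1) (real p)"
  have \<beta>1: "\<rho> / (1 + \<rho>) = 1 - \<beta>" using \<rho>0 by (simp add: \<beta>_def field_simps)
  have a1: "a * ln p1 = - (1 - \<beta>) * ln (real p)"
  proof -
    have "ln p1 \<noteq> 0" using ln by simp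
    then show ?thesis
      using p1 unfolding a_def \<beta>1 by (simp add: log_def ln_div field_simps)
  qed
  have a2: "a * ln p2 = - \<beta> * ln (real p)"
  proof -
    have "\<rho> * (a * ln p2) = a * ln p1" using ln by (simp add: \<rho>)
    also have "\<dots> = - (1 - \<beta>) * ln (real p)" by (rule a1)
    also have "1 - \<beta> = \<rho> * \<beta>" using \<rho>0 by (simp add: \<beta>_def field_simps)
    finally have "\<rho> * (a * ln p2) = \<rho> * (- \<beta> * ln (real p))" by simp
    then show ?thesis using \<rho>0 by (simp only: mult_cancel_left) simp
  qed
  \<comment> \<open>Nonnegativity keeps \<open>nat\<close> in \<open>kappa\<close> from truncating,
    so that \<kappa> lies between \<open>a\<close> and \<open>a + 1\<close>.\<close>
  have a0: "0 \<le> a"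
  proof (rule ccontr)
    assume "\<not> 0 \<le> a"
    then have "0 < a * ln p2" using ln by (simp add: mult_neg_neg)
    moreover have "0 \<le> \<beta> * ln (real p)" using \<beta> lnp by simp
    ultimately show False using a2 by simp
  qed
  have \<kappa>: "a \<le> real \<kappa>" "real \<kappa> \<le> a + 1"
    unfolding \<kappa>_def kappa_def a_def[symmetric] using a0 by linarith+
  have "(1 / p1) ^ \<kappa> = exp (real \<kappa> * - ln p1)"
    using p1 by (simp add: exp_of_nat_mult exp_minus inverse_eq_divide power_divide)
  also have "\<dots> \<le> exp ((a + 1) * - ln p1)"
    using \<kappa> ln by (auto intro!: mult_right_mono)
  also have "\<dots> = exp ((1 - \<beta>) * ln (real p)) / p1"
  proof -
    have "(a + 1) * - ln p1 = (1 - \<beta>) * ln (real p) - ln p1"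
      using a1 by (simp add: algebra_simps)
    then show ?thesis using p1 by (simp only: exp_diff) simp
  qed
  also have "\<dots> = real p powr (1 - \<beta>) / p1" using p by (simp add: powr_def)
  also have "\<dots> \<le> real p powr (1 - \<beta>) / lo"
    using p1 by (intro divide_left_mono) auto
  finally show "(1 / p1) ^ \<kappa> \<le> real p powr (1 - \<beta>) / lo" .
  have "p2 ^ \<kappa> = exp (real \<kappa> * ln p2)"
    using p1 p2 by (simp add: exp_of_nat_mult)
  also have "\<dots> \<le> exp (a * ln p2)" using \<kappa> ln by simp
  also have "\<dots> = real p powr - \<beta>" using a2 p by (simp add: powr_def)
  finally show "p2 ^ \<kappa> \<le> real p powr - \<beta>" .
  have "a * - ln hi \<le> a * - ln p2" using a0 ln by (intro mult_left_mono) auto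
  also have "\<dots> = \<beta> * ln (real p)" using a2 by simp
  also have "\<dots> \<le> 1 * ln (real n)" using \<beta> lnp by (intro mult_mono) auto
  finally have a: "a \<le> \<bar>1 / ln hi\<bar> * ln (real n)" using ln by (simp add: field_simps)
  define u where "u = \<bar>1 / ln hi\<bar>"
  have "0 \<le> u" by (simp add: u_def)
  then have "real (\<kappa> + 5) \<le> (6 + u) * (1 + ln (real n))"
    using \<kappa> lnp a[folded u_def] by (simp add: algebra_simps)
  then show "real (\<kappa> + 5) \<le> (6 + \<bar>1 / ln hi\<bar>) * (1 + ln (real n))"
    by (simp only: u_def)
qed

text \<open>
  Applied with \<open>b\<close> the claimed bound on the load, this makes the load an affine function of the
  number of collisions, so that linearity of expectation suffices.
\<close>

lemma sqrt_le_am_gm: "0 < (b::real) \<Longrightarrow> 0 \<le> a \<Longrightarrow> sqrt a \<le> (b + a / b) / 2"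
  using zero_le_power2[of "sqrt a - b"] by (simp add: field_simps power2_eq_square)

text \<open>An integrable majorant is one of the functions over which the infimum is taken, so
  measurability of \<open>f\<close> never comes up.\<close>

lemma upper_expectation_le_integral:
  assumes "integrable M g" "\<And>\<omega>. \<omega> \<in> space M \<Longrightarrow> 0 \<le> f \<omega> \<and> f \<omega> \<le> g \<omega>" "integral\<^sup>L M g \<le> B"
  shows "upper_expectation M f \<le> ennreal B"
proof -
  have "upper_expectation M f \<le> (\<integral>\<^sup>+\<omega>. ennreal (g \<omega>) \<partial>M)"
    unfolding upper_expectation_def using assms(1,2)
    by (intro INF_lower) (auto intro!: ennreal_leI)
  also have "\<dots> = ennreal (integral\<^sup>L M g)"
    using assms(1,2) by (intro nn_integral_eq_integral AE_I2) (auto intro: order_trans)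
  also have "\<dots> \<le> ennreal B" using assms(3) by (rule ennreal_leI)
  finally show ?thesis .
qed

text \<open>The bound is the square of a load because it is the size of a join divided by
  \<open>p\<close>; its square root is what the join primitive pays.\<close>

lemma expected_collisions_bound:
  fixes p n :: nat and t :: "nat \<Rightarrow> nat"
  assumes lsh: "lsh_family U d r (c * r) p1 p2 H" and thr: "threshold_prob U d r p1 H"
    and p1: "0 < lo" "lo \<le> p1" "p1 < 1" and p2: "lo \<le> p2" "p2 \<le> hi" "hi < 1"
    and \<rho>: "\<rho> = ln p1 / ln p2" and p: "1 \<le> p" "p \<le> n"
    and \<kappa>: "\<kappa> = kappa p1 \<rho> p"
    and t: "\<forall>i\<le>\<kappa>. real (t i) \<le> c\<^sub>2 * (1 / p1) ^ i" and c2: "0 < c\<^sub>2"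
    and X: "finite X" "X \<subseteq> U" and Y: "finite Y" "Y \<subseteq> U" and n: "n = card X + card Y"
    and k: "\<forall>x\<in>X. optimal_level H p1 \<kappa> Y x (k x)"
  shows "(\<Sum>x\<in>X. real (t (k x)) * (\<Sum>y\<in>Y. level_coll H (k x) x y)) / real p \<le>
     2 * c\<^sub>2 / lo *
     (sqrt (\<Sum>i\<le>\<kappa>.
        real (card {(x, y) \<in> X \<times> Y. d x y \<le> r \<and> dense n p2 \<kappa> i (near_count d r Y x)}) / (real p * p1 ^ i)) +
      sqrt (real (card {(x, y) \<in> X \<times> Y. r < d x y \<and> d x y \<le> c * r}) / real p) +
      real n / real p powr (1 / (1 + \<rho>)))\<^sup>2"
proof -
  define \<beta> where "\<beta> = 1 / (1 + \<rho>)"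
  define V where "V = real n / real p powr \<beta>"
  define N where "N = (\<Sum>i\<le>\<kappa>. (1 / p1) ^ i *
     real (card {(x, y) \<in> X \<times> Y. d x y \<le> r \<and> dense n p2 \<kappa> i (near_count d r Y x)}))"
  define M where "M = real (card {(x, y) \<in> X \<times> Y. r < d x y \<and> d x y \<le> c * r})"
  have NP: "N / real p = (\<Sum>i\<le>\<kappa>.
     real (card {(x, y) \<in> X \<times> Y. d x y \<le> r \<and> dense n p2 \<kappa> i (near_count d r Y x)}) / (real p * p1 ^ i))"
    unfolding N_def sum_divide_distrib by (intro sum.cong refl) (simp add: power_divide mult.commute)
  note \<beta> = kappa_bounds[OF p1 p2 \<rho> p, folded \<beta>_def \<kappa>]
  have p0: "0 < real p" "1 \<le> real p" "real p \<le> real n" using p by auto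
  have p1': "0 < p1" "0 < p2" using p1 p2 by linarith+
  have lc: "level_coll H i x y = coll H x y ^ i" if "x \<in> U" "y \<in> U" for i x y
    using lsh that by (intro level_coll_eq[of H U]) (auto simp: lsh_family_def)
  have NM: "0 \<le> N" "0 \<le> M" using p1' by (auto simp: N_def M_def intro!: sum_nonneg)
  have lo1: "1 \<le> 1 / lo" using p1 by simp
  have "real p powr \<beta> \<le> real p powr 1" using \<beta> p0 by (intro powr_mono) auto
  then have V1: "1 \<le> V" using p0 by (simp add: V_def)
  have pow: "real p powr (1 - \<beta>) / real p = real p powr - \<beta>" "real n * real p powr - \<beta> = V"
    using p0 by (simp_all add: powr_diff powr_minus V_def field_simps)
  \<comment> \<open>The replication term is of order \<open>V\<close>, which is below its square
    because p^\<beta> \<le> p \<le> n gives \<open>1 \<le> V\<close>.\<close>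
  have e1: "real n * (1 / p1) ^ \<kappa> / real p \<le> 1 / lo * V\<^sup>2"
  proof -
    have "real n * (1 / p1) ^ \<kappa> / real p \<le> real n * (real p powr (1 - \<beta>) / lo) / real p"
      using \<beta>(3) p0 by (intro divide_right_mono mult_left_mono) auto
    also have "\<dots> = 1 / lo * (real n * (real p powr (1 - \<beta>) / real p))"
      by simp
    also have "\<dots> = 1 / lo * V" unfolding pow ..
    also have "\<dots> \<le> 1 / lo * V\<^sup>2"
      using V1 p1 by (intro mult_left_mono) (auto simp: power2_eq_square)
    finally show ?thesis .
  qed
  \<comment> \<open>One factor \<open>n * p powr - \<beta>\<close> comes from
    \<open>p2 ^ \<kappa>\<close> and a second one from \<open>(1 / p1) ^ \<kappa> / p\<close>, so
    their product is the square of \<open>V\<close>.\<close>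
  have e2: "real n * (real n * (p2 / p1) ^ \<kappa>) / real p \<le> 1 / lo * V\<^sup>2"
  proof -
    have "(p2 / p1) ^ \<kappa> = p2 ^ \<kappa> * (1 / p1) ^ \<kappa>" by (simp add: power_divide)
    also have "\<dots> \<le> real p powr - \<beta> * (real p powr (1 - \<beta>) / lo)"
      using \<beta>(3,4) p1' by (intro mult_mono) auto
    finally have "real n * (real n * (p2 / p1) ^ \<kappa>) / real p \<le>
        real n * (real n * (real p powr - \<beta> * (real p powr (1 - \<beta>) / lo))) / real p"
      using p0 by (intro divide_right_mono mult_left_mono) auto
    also have "\<dots> = 1 / lo * ((real n * real p powr - \<beta>) * (real n * (real p powr (1 - \<beta>) / real p)))"
      by (simp add: mult_ac)
    also have "\<dots> = 1 / lo * V\<^sup>2" unfolding pow by (simp add: power2_eq_square)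
    finally show ?thesis .
  qed
  have "(\<Sum>x\<in>X. real (t (k x)) * (\<Sum>y\<in>Y. level_coll H (k x) x y)) \<le>
      (\<Sum>x\<in>X. c\<^sub>2 * (1 / p1) ^ k x * (\<Sum>y\<in>Y. level_coll H (k x) x y))"
    using k t by (intro sum_mono mult_right_mono sum_nonneg)
      (auto simp: optimal_level_def is_arg_min_def level_coll_def)
  also have "\<dots> = c\<^sub>2 * (\<Sum>x\<in>X. (1 / p1) ^ k x * (\<Sum>y\<in>Y. level_coll H (k x) x y))"
    by (simp add: sum_distrib_left mult_ac)
  also have "\<dots> \<le> c\<^sub>2 * (real n * (1 / p1) ^ \<kappa> + (1 + 1 / lo) * N + M + real n * (real n * (p2 / p1) ^ \<kappa>))"
    using c2 unfolding N_def M_def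
    by (intro mult_left_mono total_level_cost_bound[OF lsh thr lc p1'(1) p1(3) p2(1) p1(1) X Y n k]) auto
  finally have "(\<Sum>x\<in>X. real (t (k x)) * (\<Sum>y\<in>Y. level_coll H (k x) x y)) / real p \<le>
      c\<^sub>2 * (real n * (1 / p1) ^ \<kappa> + (1 + 1 / lo) * N + M + real n * (real n * (p2 / p1) ^ \<kappa>)) / real p"
    using p0 by (intro divide_right_mono) auto
  also have "\<dots> = c\<^sub>2 * (real n * (1 / p1) ^ \<kappa> / real p + (1 + 1 / lo) * (N / real p) + M / real p +
      real n * (real n * (p2 / p1) ^ \<kappa>) / real p)"
    by (simp only: add_divide_distrib times_divide_eq_right[symmetric])
  \<comment> \<open>Since \<open>lo < 1\<close>, all coefficients fit under \<open>2 / lo\<close>;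
    the square of \<open>V\<close> appears once from \<open>e1\<close> and once from
    \<open>e2\<close>.\<close>
  also have "\<dots> \<le> c\<^sub>2 * (1 / lo * V\<^sup>2 + (2 * (1 / lo)) * (N / real p) + (2 * (1 / lo)) * (M / real p) + 1 / lo * V\<^sup>2)"
  proof -
    have "(1 + 1 / lo) * (N / real p) \<le> (2 * (1 / lo)) * (N / real p)"
      using lo1 NM by (intro mult_right_mono) auto
    moreover have "1 * (M / real p) \<le> (2 * (1 / lo)) * (M / real p)"
      using lo1 NM by (intro mult_right_mono) auto
    ultimately show ?thesis
      using e1 e2 c2 by (intro mult_left_mono) auto
  qed
  also have "\<dots> = 2 * c\<^sub>2 / lo * (N / real p + M / real p + V\<^sup>2)"
    by (simp add: algebra_simps)
  also have "\<dots> \<le> 2 * c\<^sub>2 / lo * (sqrt (N / real p) + sqrt (M / real p) + V)\<^sup>2"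
  proof (rule mult_left_mono)
    have "0 \<le> sqrt (N / real p) * sqrt (M / real p)" "0 \<le> sqrt (N / real p) * V" "0 \<le> sqrt (M / real p) * V"
      using NM V1 by auto
    moreover have "(sqrt (N / real p))\<^sup>2 = N / real p" "(sqrt (M / real p))\<^sup>2 = M / real p"
      using NM by auto
    moreover have "(x + y + z)\<^sup>2 = x\<^sup>2 + y\<^sup>2 + z\<^sup>2 + 2 * (x * y) + 2 * (x * z) + 2 * (y * z)" for x y z :: real
      by (simp add: power2_eq_square algebra_simps)
    ultimately show "N / real p + M / real p + V\<^sup>2 \<le> (sqrt (N / real p) + sqrt (M / real p) + V)\<^sup>2"
      by simp
  qed (use c2 p1 in auto)
  finally show ?thesis
    unfolding NP M_def V_def \<beta>_def .
qed

text \<open>The cost of each side involves near pairs in which the point of that side is dense,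
  whereas \<open>OUT_near\<close> admits density of either endpoint. Symmetry of \<open>d\<close>
  transposes the pairs counted from \<open>S\<close>.\<close>

lemma OUT_near_bounds:
  assumes "distance_function U d" "R \<subseteq> U" "S \<subseteq> U" "finite R" "finite S" "n = card R + card S"
  shows "card {(x, y) \<in> R \<times> S. d x y \<le> r \<and> dense n p2 \<kappa> i (near_count d r S x)} \<le> OUT_near d r p2 \<kappa> R S i"
    and "card {(y, x) \<in> S \<times> R. d y x \<le> r \<and> dense n p2 \<kappa> i (near_count d r R y)} \<le> OUT_near d r p2 \<kappa> R S i"
    and "card {(y, x) \<in> S \<times> R. r < d y x \<and> d y x \<le> b} = card {(x, y) \<in> R \<times> S. r < d x y \<and> d x y \<le> b}"
proof -
  have sym: "d y x = d x y" if "x \<in> R" "y \<in> S" for x y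
    using that assms(1-3) unfolding distance_function_def by blast
  have swap: "card {(y, x) \<in> S \<times> R. P y x} = card {(x, y) \<in> R \<times> S. P y x}" for P
    by (rule bij_betw_same_card[of prod.swap], rule bij_betwI[where g = prod.swap]) auto
  have fin: "finite {(x, y) \<in> R \<times> S. P x y}" for P
    by (rule finite_subset[of _ "R \<times> S"]) (use assms(4,5) in auto)
  show "card {(x, y) \<in> R \<times> S. d x y \<le> r \<and> dense n p2 \<kappa> i (near_count d r S x)} \<le> OUT_near d r p2 \<kappa> R S i"
    unfolding OUT_near_def using assms(6) by (intro card_mono[OF fin]) auto
  have "{(x, y) \<in> R \<times> S. d y x \<le> r \<and> dense n p2 \<kappa> i (near_count d r R y)} \<subseteq>
    {(x, y) \<in> R \<times> S. d x y \<le> r \<and> (dense (card R + card S) p2 \<kappa> i (near_count d r S x) \<or>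
       dense (card R + card S) p2 \<kappa> i (near_count d r R y))}"
    using sym assms(6) by auto
  then show "card {(y, x) \<in> S \<times> R. d y x \<le> r \<and> dense n p2 \<kappa> i (near_count d r R y)} \<le> OUT_near d r p2 \<kappa> R S i"
    unfolding swap OUT_near_def by (rule card_mono[OF fin])
  have "{(x, y) \<in> R \<times> S. r < d y x \<and> d y x \<le> b} = {(x, y) \<in> R \<times> S. r < d x y \<and> d x y \<le> b}"
    using sym by auto
  then show "card {(y, x) \<in> S \<times> R. r < d y x \<and> d y x \<le> b} = card {(x, y) \<in> R \<times> S. r < d x y \<and> d x y \<le> b}"
    unfolding swap by simp
qed

text \<open>The value of \<delta> is chosen so that p < n^\<epsilon> becomes p^(1 + \<delta>) < n.
  The constants are quantified before the space, the hash family and the input, so they depend only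
  on the fixed parameters and the primitives. The number of rounds is bounded for the protocol
  itself, the load in expectation over the hash functions.\<close>

theorem theorem3:
  fixes \<epsilon> \<delta> lo hi c\<^sub>1 c\<^sub>2 :: real
    and srt :: "nat \<Rightarrow> ('u word, 'u tup list, 'u tup list) protocol"
    and scan :: "(real list option \<Rightarrow> real list option \<Rightarrow> real list option) \<Rightarrow> nat \<Rightarrow>
      ('u word, real list option list, real list option list) protocol"
    and ejoin :: "nat \<Rightarrow> ('u word, 'u tup list \<times> 'u tup list, ('u tup \<times> 'u tup) list) protocol"
  assumes "0 < \<epsilon>" "\<epsilon> < 1" "\<delta> = 1 / \<epsilon> - 1"
    and "0 < lo" "hi < 1" "0 < c\<^sub>1"
    and "sorting_primitive tup_size tup_le \<delta> srt"
    and "prefix_sums_primitive opt_key_size \<delta> scan"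
    and "equi_join_primitive tup_size group_key \<delta> ejoin"
  shows "\<exists>(K::nat) (C::real) (e::nat).
    \<forall>(U :: 'u set) d r c p1 p2 \<rho> H R S n p \<kappa> t k inp.
      distance_function U d \<and> 0 < r \<and> 1 < c \<and>
      lo \<le> p1 \<and> p1 < 1 \<and> lo \<le> p2 \<and> p2 \<le> hi \<and>
      lsh_family U d r (c * r) p1 p2 H \<and> threshold_prob U d r p1 H \<and>
      \<rho> = ln p1 / ln p2 \<and>
      finite R \<and> finite S \<and> R \<subseteq> U \<and> S \<subseteq> U \<and> n = card R + card S \<and>
      1 \<le> p \<and> real p < real n powr \<epsilon> \<and> evenly_distributed p R S inp \<and>
      \<kappa> = kappa p1 \<rho> p \<and>
      (\<forall>i\<le>\<kappa>. c\<^sub>1 * (1 / p1) ^ i \<le> real (t i) \<and> real (t i) \<le> c\<^sub>2 * (1 / p1) ^ i) \<and>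
      (\<forall>x\<in>R. optimal_level H p1 \<kappa> S x (k R_side x)) \<and>
      (\<forall>y\<in>S. optimal_level H p1 \<kappa> R y (k S_side y)) \<longrightarrow>
      rounds (lsh_join srt scan ejoin \<delta> p \<kappa> t d r) \<le> K \<and>
      upper_expectation (hash_sample H \<kappa> t)
        (\<lambda>\<omega>. real (load (lsh_join srt scan ejoin \<delta> p \<kappa> t d r) p (join_input \<kappa> t k inp \<omega>)))
      \<le> ennreal (C * (1 + ln (real n)) ^ e *
          (sqrt (\<Sum>i=0..\<kappa>. real (OUT_near d r p2 \<kappa> R S i) / (real p * p1 ^ i)) +
           sqrt (real (OUT_c_near d r c R S) / real p) +
           real n / real p powr (1 / (1 + \<rho>))))"
proof -
  have \<delta>: "0 < \<delta>" using assms(1,2) unfolding assms(3) by (simp add: field_simps)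
  obtain K C0 where C0: "1 \<le> C0" and load: "\<And>p \<kappa> t d r inp k \<omega> L.
    1 \<le> p \<Longrightarrow> real p powr \<delta> \<le> real L \<Longrightarrow> distinct (gather p inp) \<Longrightarrow>
    \<forall>q<p. length (inp q) * (\<Sum>i\<le>\<kappa>. t i) \<le> L \<Longrightarrow>
    rounds (lsh_join srt scan ejoin \<delta> p \<kappa> t d r) \<le> K \<and>
    real (load (lsh_join srt scan ejoin \<delta> p \<kappa> t d r) p (join_input \<kappa> t k inp \<omega>)) \<le>
      real (nat \<lceil>real p powr \<delta>\<rceil> * length (hash_slots \<kappa> t)) +
      C0 * real (\<kappa> + 5) * (real L +
        sqrt (real (active_collisions t k (set (gather p inp)) \<omega> R_side S_side) / real p) +
        sqrt (real (active_collisions t k (set (gather p inp)) \<omega> S_side R_side) / real p))"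
    by (rule load_lsh_join[OF \<delta> assms(7-9)]) (rule that)
  \<comment> \<open>\<open>q\<close> bounds \<open>\<kappa> + 5\<close> relative to the logarithm,
    \<open>Q\<close> is the factor for the expected join size, and \<open>cT\<close> is the one for
    the number of repetitions. In \<open>C\<close> the first summand pays for the broadcast,
    \<open>2 * (1 + cT)\<close> for the tuples and \<open>1 + Q\<close> for the join
    outputs.\<close>
  define q where "q = 6 + \<bar>1 / ln hi\<bar>"
  define Q where "Q = 2 * c\<^sub>2 / lo"
  define cT where "cT = q * c\<^sub>2 / lo"
  define C where "C = 2 * q * cT + C0 * q * (2 * (1 + cT) + (1 + Q))"
  have main: "rounds (lsh_join srt scan ejoin \<delta> p \<kappa> t d r) \<le> K \<and>
      upper_expectation (hash_sample H \<kappa> t)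
        (\<lambda>\<omega>. real (load (lsh_join srt scan ejoin \<delta> p \<kappa> t d r) p (join_input \<kappa> t k inp \<omega>)))
      \<le> ennreal (C * (1 + ln (real n)) ^ 2 *
          (sqrt (\<Sum>i=0..\<kappa>. real (OUT_near d r p2 \<kappa> R S i) / (real p * p1 ^ i)) +
           sqrt (real (OUT_c_near d r c R S) / real p) +
           real n / real p powr (1 / (1 + \<rho>))))"
    if d: "distance_function U d" and p1: "lo \<le> p1" "p1 < 1" and p2: "lo \<le> p2" "p2 \<le> hi"
      and lsh: "lsh_family U d r (c * r) p1 p2 H" and thr: "threshold_prob U d r p1 H"
      and \<rho>: "\<rho> = ln p1 / ln p2"
      and RS: "finite R" "finite S" "R \<subseteq> U" "S \<subseteq> U" and n: "n = card R + card S"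
      and p: "1 \<le> p" "real p < real n powr \<epsilon>" and ev: "evenly_distributed p R S inp"
      and \<kappa>: "\<kappa> = kappa p1 \<rho> p"
      and t: "\<forall>i\<le>\<kappa>. c\<^sub>1 * (1 / p1) ^ i \<le> real (t i) \<and> real (t i) \<le> c\<^sub>2 * (1 / p1) ^ i"
      and kR: "\<forall>x\<in>R. optimal_level H p1 \<kappa> S x (k R_side x)"
      and kS: "\<forall>y\<in>S. optimal_level H p1 \<kappa> R y (k S_side y)"
    for U :: "'u set" and d r c p1 p2 \<rho> H R S n p \<kappa> t k inp
  proof
    define \<beta> where "\<beta> = 1 / (1 + \<rho>)"
    define V where "V = real n / real p powr \<beta>"
    define X where "X = (\<Sum>i\<le>\<kappa>. real (OUT_near d r p2 \<kappa> R S i) / (real p * p1 ^ i))"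
    define Y where "Y = real (OUT_c_near d r c R S) / real p"
    define B where "B = sqrt X + sqrt Y + V"
    define l where "l = 1 + ln (real n)"
    define T where "T = (\<Sum>i\<le>\<kappa>. t i)"
    \<comment> \<open>\<open>T\<close> bounds the tuples generated per point. The added 1 gives
      \<open>n / p \<le> L\<close>, and hence the size condition of the primitives.\<close>
    define L where "L = nat \<lceil>real n / real p\<rceil> * (1 + T)"
    define Z where "Z = set (gather p inp)"
    define M where "M = hash_sample H \<kappa> t"
    define J where "J \<omega> s s' = real (active_collisions t k Z \<omega> s s') / real p" for \<omega> s s'
    have n1: "1 < real n powr \<epsilon>" using p by linarith
    then have n0: "1 \<le> real n" by (cases "n = 0") auto
    have p0: "0 < real p" "1 \<le> real p" using p by auto
    have pn: "p \<le> n"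
    proof -
      have "real n powr \<epsilon> \<le> real n powr 1" using n0 assms(1,2) by (intro powr_mono) auto
      with p n0 show ?thesis by simp
    qed
    have pd: "real p powr (1 + \<delta>) \<le> real n"
    proof -
      have "real p powr (1 + \<delta>) \<le> (real n powr \<epsilon>) powr (1 + \<delta>)"
        using p p0 \<delta> by (intro powr_mono2) auto
      also have "\<dots> = real n" using n0 assms(1,3) by (simp add: powr_powr)
      finally show ?thesis .
    qed
    have p1': "0 < p1" "0 < p2" using p1 p2 assms(4) by linarith+
    have c2: "0 < c\<^sub>2"
      using t[rule_format, of 0] assms(6) by simp
    note \<beta> = kappa_bounds[OF assms(4) p1 p2 assms(5) \<rho> p(1) pn, folded \<beta>_def \<kappa> q_def l_def]
    have l1: "1 \<le> l" using n0 by (simp add: l_def)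
    have q0: "0 < q" by (simp add: q_def add_pos_nonneg)
    have cT0: "0 \<le> cT" using q0 c2 assms(4) by (simp add: cT_def)
    have V1: "0 < V" using n0 p0 by (simp add: V_def)
    have XY: "0 \<le> X" "0 \<le> Y" using p1' by (auto simp: X_def Y_def intro!: sum_nonneg)
    then have B: "0 < B" "V \<le> B" using V1 by (auto simp: B_def add_nonneg_pos)
    have pow: "real p powr (1 - \<beta>) / real p = 1 / real p powr \<beta>" using p0 by (simp add: powr_diff)

    \<comment> \<open>Summing the geometric series exactly would bring in
      \<open>1 / (1 - p1)\<close>, which is not uniformly bounded. Taking the largest term
      \<open>\<kappa> + 1\<close> times costs a logarithm instead.\<close>
    have T: "real T \<le> cT * l * real p powr (1 - \<beta>)"
    proof -
      have "real T \<le> (\<Sum>i\<le>\<kappa>. c\<^sub>2 * (1 / p1) ^ \<kappa>)"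
        unfolding T_def of_nat_sum
      proof (rule sum_mono)
        fix i assume i: "i \<in> {..\<kappa>}"
        have "c\<^sub>2 * (1 / p1) ^ i \<le> c\<^sub>2 * (1 / p1) ^ \<kappa>"
          using i c2 p1' p1 by (intro mult_left_mono power_increasing) auto
        with t i show "real (t i) \<le> c\<^sub>2 * (1 / p1) ^ \<kappa>" by force
      qed
      also have "\<dots> = real (\<kappa> + 1) * (c\<^sub>2 * (1 / p1) ^ \<kappa>)" by simp
      also have "\<dots> \<le> (q * l) * (c\<^sub>2 * (real p powr (1 - \<beta>) / lo))"
        using \<beta>(3,5) c2 p1' q0 l1 by (intro mult_mono) auto
      also have "\<dots> = cT * l * real p powr (1 - \<beta>)" by (simp add: cT_def)
      finally show ?thesis .
    qed
    \<comment> \<open>A concatenation has at most \<kappa> words. The powers of p combine to p^(1 +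
      \<delta>) / p^\<beta> \<le> n / p^\<beta>, which is where the fan-out is paid for.\<close>
    have slots: "real (nat \<lceil>real p powr \<delta>\<rceil> * length (hash_slots \<kappa> t)) \<le> 2 * q * cT * l\<^sup>2 * V"
    proof -
      have "length (hash_slots \<kappa> t) \<le> (\<Sum>i\<le>\<kappa>. t i * \<kappa>)"
        unfolding length_hash_slots by (intro sum_mono mult_left_mono) auto
      also have "\<dots> = \<kappa> * T" by (simp add: T_def sum_distrib_left mult.commute)
      finally have "real (length (hash_slots \<kappa> t)) \<le> real \<kappa> * real T"
        by (simp flip: of_nat_mult)
      also have "\<dots> \<le> (q * l) * (cT * l * real p powr (1 - \<beta>))"
        using \<beta>(5) T q0 l1 by (intro mult_mono) auto
      finally have h: "real (length (hash_slots \<kappa> t)) \<le> (q * l) * (cT * l * real p powr (1 - \<beta>))" .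
      have "1 \<le> real p powr \<delta>" using p0 \<delta> by (simp add: ge_one_powr_ge_zero)
      then have f: "real (nat \<lceil>real p powr \<delta>\<rceil>) \<le> 2 * real p powr \<delta>" by linarith
      have "real (nat \<lceil>real p powr \<delta>\<rceil> * length (hash_slots \<kappa> t)) \<le>
          (2 * real p powr \<delta>) * ((q * l) * (cT * l * real p powr (1 - \<beta>)))"
        unfolding of_nat_mult using f h by (intro mult_mono) auto
      also have "\<dots> = 2 * q * cT * l\<^sup>2 * (real p powr \<delta> * real p powr (1 - \<beta>))"
        by (simp add: power2_eq_square)
      also have "real p powr \<delta> * real p powr (1 - \<beta>) = real p powr (1 + \<delta>) / real p powr \<beta>"
        using p0 by (simp add: powr_diff powr_add)
      also have "\<dots> \<le> V" unfolding V_def using pd by (intro divide_right_mono) auto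
      finally show ?thesis using q0 cT0 by (simp add: mult_left_mono)
    qed
    have np: "1 \<le> real n / real p" using p0 pn by simp
    then have np2: "real (nat \<lceil>real n / real p\<rceil>) \<le> 2 * (real n / real p)" by linarith
    have L: "real L \<le> 2 * (1 + cT) * l * V"
    proof -
      have "1 * 1 \<le> l * real p powr (1 - \<beta>)"
        using l1 \<beta> p0 by (intro mult_mono ge_one_powr_ge_zero) auto
      with T have T': "1 + real T \<le> (1 + cT) * l * real p powr (1 - \<beta>)"
        by (simp add: algebra_simps)
      have "real L = real (nat \<lceil>real n / real p\<rceil>) * (1 + real T)"
        by (simp add: L_def algebra_simps)
      also have "\<dots> \<le> 2 * (real n / real p) * ((1 + cT) * l * real p powr (1 - \<beta>))"
        using np2 T' np by (intro mult_mono) auto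
      also have "\<dots> = 2 * (1 + cT) * l * (real n * (real p powr (1 - \<beta>) / real p))" by simp
      also have "\<dots> = 2 * (1 + cT) * l * V" unfolding pow V_def by simp
      finally show ?thesis .
    qed
    have Lp: "real p powr \<delta> \<le> real L"
    proof -
      have "real p powr \<delta> = real p powr (1 + \<delta>) / real p" using p0 by (simp add: powr_add)
      also have "\<dots> \<le> real n / real p" using pd by (intro divide_right_mono) auto
      also have "\<dots> \<le> real (nat \<lceil>real n / real p\<rceil>) * 1"
        using real_nat_ceiling_ge[of "real n / real p"] by linarith
      also have "\<dots> \<le> real L" unfolding L_def of_nat_mult by (intro mult_left_mono of_nat_0_le_iff) simp
      finally show ?thesis .
    qed
    have len: "\<forall>q<p. length (inp q) * (\<Sum>i\<le>\<kappa>. t i) \<le> L"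
    proof (intro allI impI)
      fix j assume "j < p"
      then have "length (inp j) \<le> nat \<lceil>real n / real p\<rceil>"
        using ev n by (simp add: evenly_distributed_def)
      then show "length (inp j) * (\<Sum>i\<le>\<kappa>. t i) \<le> L"
        unfolding L_def T_def by (intro mult_le_mono) simp_all
    qed
    have dist: "distinct (gather p inp)" and Z: "Z = {R_side} \<times> R \<union> {S_side} \<times> S"
      using ev by (auto simp: evenly_distributed_def Z_def)
    note load' = load[OF p(1) Lp dist len, folded Z_def]
    show "rounds (lsh_join srt scan ejoin \<delta> p \<kappa> t d r) \<le> K" using load' by blast

    have H: "prob_space H" "\<forall>x\<in>U. (\<lambda>h. h x) \<in> borel_measurable H"
      using lsh by (auto simp: lsh_family_def)
    have sides: "{x. (R_side, x) \<in> Z} = R" "{x. (S_side, x) \<in> Z} = S" by (auto simp: Z)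
    have Z': "finite Z" "snd ` Z \<subseteq> U" "\<And>s x. (s, x) \<in> Z \<Longrightarrow> k s x \<le> \<kappa>"
      using RS kR kS by (auto simp: Z optimal_level_def is_arg_min_def)
    have t': "\<forall>i\<le>\<kappa>. real (t i) \<le> c\<^sub>2 * (1 / p1) ^ i" using t by blast
    have int: "integrable M (\<lambda>\<omega>. J \<omega> s s')" for s s'
      unfolding J_def M_def
      by (intro integrable_divide active_collisions_measurable_expectation(1)[OF H Z'])
    have EJ: "integral\<^sup>L M (\<lambda>\<omega>. J \<omega> s s') =
        (\<Sum>x | (s, x) \<in> Z. real (t (k s x)) * (\<Sum>y | (s', y) \<in> Z. level_coll H (k s x) x y)) / real p"
      for s s'
      unfolding J_def M_def integral_divide_zero
      using active_collisions_measurable_expectation(2)[OF H Z'(1,2), where s = s and k = k and \<kappa> = \<kappa>] Z'(3)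
      by simp
    \<comment> \<open>\<open>a\<close> will be the near-pair counts by density on one side.
      Comparing them with \<open>OUT_near\<close> brings the bounds for both sides under the same
      \<open>B\<close>.\<close>
    have mono: "Q * (sqrt (\<Sum>i\<le>\<kappa>. real (a i) / (real p * p1 ^ i)) + sqrt (Y' / real p) +
        real n / real p powr (1 / (1 + \<rho>)))\<^sup>2 \<le> Q * B\<^sup>2"
      if "\<And>i. a i \<le> OUT_near d r p2 \<kappa> R S i" "Y' = real (OUT_c_near d r c R S)" for a Y'
    proof -
      have "(\<Sum>i\<le>\<kappa>. real (a i) / (real p * p1 ^ i)) \<le> X"
        unfolding X_def using that p0 p1' by (intro sum_mono divide_right_mono) auto
      moreover have "0 \<le> (\<Sum>i\<le>\<kappa>. real (a i) / (real p * p1 ^ i))"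
        using p1' by (intro sum_nonneg) auto
      ultimately have "(sqrt (\<Sum>i\<le>\<kappa>. real (a i) / (real p * p1 ^ i)) + sqrt (Y' / real p) +
          real n / real p powr (1 / (1 + \<rho>)))\<^sup>2 \<le> B\<^sup>2"
        using that(2) XY V1 unfolding B_def Y_def V_def \<beta>_def
        by (intro power_mono add_mono order_refl real_sqrt_le_mono add_nonneg_nonneg) auto
      then show ?thesis
        unfolding Q_def using c2 assms(4) by (intro mult_left_mono) auto
    qed
    note bound = expected_collisions_bound[OF lsh thr assms(4) p1 p2 assms(5) \<rho> p(1) pn \<kappa> t' c2, folded Q_def]
    note OUT = OUT_near_bounds[OF d RS(3,4,1,2) n]
    have "integral\<^sup>L M (\<lambda>\<omega>. J \<omega> R_side S_side) =
        (\<Sum>x\<in>R. real (t (k R_side x)) * (\<Sum>y\<in>S. level_coll H (k R_side x) x y)) / real p"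
      by (simp add: EJ sides)
    also have "\<dots> \<le> Q * B\<^sup>2"
      by (rule order_trans[OF bound[OF RS(1,3,2,4) n kR] mono]) (use OUT in \<open>auto simp: OUT_c_near_def\<close>)
    finally have EJ1: "integral\<^sup>L M (\<lambda>\<omega>. J \<omega> R_side S_side) \<le> Q * B\<^sup>2" .
    have n': "n = card S + card R" using n by simp
    have "integral\<^sup>L M (\<lambda>\<omega>. J \<omega> S_side R_side) =
        (\<Sum>x\<in>S. real (t (k S_side x)) * (\<Sum>y\<in>R. level_coll H (k S_side x) x y)) / real p"
      by (simp add: EJ sides)
    also have "\<dots> \<le> Q * B\<^sup>2"
      by (rule order_trans[OF bound[OF RS(2,4,1,3) n' kS] mono]) (use OUT in \<open>auto simp: OUT_c_near_def\<close>)
    finally have EJ2: "integral\<^sup>L M (\<lambda>\<omega>. J \<omega> S_side R_side) \<le> Q * B\<^sup>2" .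

    define D where "D = C0 * (q * l)"
    have D: "0 \<le> D" using C0 q0 l1 by (simp add: D_def)
    let ?S = "2 * q * cT * l\<^sup>2 * V"
    let ?L = "2 * (1 + cT) * l * V"
    \<comment> \<open>Each square root of \<open>J\<close> is replaced by its bound (B + J / B) / 2.
      The two halves of \<open>B\<close> add up to the \<open>B\<close> next to \<open>?L\<close>,
      and the collision counts get the coefficient \<open>D / (2 * B)\<close>.\<close>
    let ?g = "\<lambda>\<omega>. (?S + D * (?L + B)) + D / (2 * B) * (J \<omega> R_side S_side + J \<omega> S_side R_side)"
    interpret M: prob_space M unfolding M_def by (rule prob_space_hash_sample[OF H(1)])
    have "upper_expectation M
        (\<lambda>\<omega>. real (load (lsh_join srt scan ejoin \<delta> p \<kappa> t d r) p (join_input \<kappa> t k inp \<omega>)))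
      \<le> ennreal (?S + D * (?L + B) + D / (2 * B) * (Q * B\<^sup>2 + Q * B\<^sup>2))"
    proof (rule upper_expectation_le_integral[where g = ?g])
      show "integrable M ?g" using int by simp
      have "integral\<^sup>L M ?g = ?S + D * (?L + B) +
          D / (2 * B) * (integral\<^sup>L M (\<lambda>\<omega>. J \<omega> R_side S_side) + integral\<^sup>L M (\<lambda>\<omega>. J \<omega> S_side R_side))"
        using int by (simp add: M.prob_space)
      also have "\<dots> \<le> ?S + D * (?L + B) + D / (2 * B) * (Q * B\<^sup>2 + Q * B\<^sup>2)"
        using EJ1 EJ2 D B by (intro add_left_mono mult_left_mono add_mono) auto
      finally show "integral\<^sup>L M ?g \<le> ?S + D * (?L + B) + D / (2 * B) * (Q * B\<^sup>2 + Q * B\<^sup>2)" .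
    next
      fix \<omega> assume "\<omega> \<in> space M"
      have J0: "0 \<le> J \<omega> s s'" for s s' by (simp add: J_def)
      have s: "sqrt (J \<omega> s s') \<le> (B + J \<omega> s s' / B) / 2" for s s'
        by (rule sqrt_le_am_gm[OF B(1) J0])
      have "real (load (lsh_join srt scan ejoin \<delta> p \<kappa> t d r) p (join_input \<kappa> t k inp \<omega>)) \<le>
        real (nat \<lceil>real p powr \<delta>\<rceil> * length (hash_slots \<kappa> t)) + C0 * real (\<kappa> + 5) *
         (real L + sqrt (J \<omega> R_side S_side) + sqrt (J \<omega> S_side R_side))"
        unfolding J_def by (rule load'[THEN conjunct2])
      also have "\<dots> \<le> ?S + D * (?L + (B + J \<omega> R_side S_side / B) / 2 + (B + J \<omega> S_side R_side / B) / 2)"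
        unfolding D_def using slots \<beta>(5) L s C0 J0 q0 l1
        by (intro add_mono mult_mono) (auto intro!: add_nonneg_nonneg)
      also have "\<dots> = ?g \<omega>"
        using B by (simp add: field_simps)
      finally show "0 \<le> real (load (lsh_join srt scan ejoin \<delta> p \<kappa> t d r) p (join_input \<kappa> t k inp \<omega>)) \<and>
        real (load (lsh_join srt scan ejoin \<delta> p \<kappa> t d r) p (join_input \<kappa> t k inp \<omega>)) \<le> ?g \<omega>" by simp
    qed
    \<comment> \<open>Expected join sizes of order \<open>B\<^sup>2\<close>, divided by
      \<open>B\<close>, contribute at the scale of \<open>B\<close> itself.\<close>
    also have "?S + D * (?L + B) + D / (2 * B) * (Q * B\<^sup>2 + Q * B\<^sup>2) = ?S + D * (?L + (1 + Q) * B)"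
      using B by (simp add: field_simps power2_eq_square)
    also have "\<dots> \<le> C * l\<^sup>2 * B"
    proof -
      have Q0: "0 \<le> Q" using c2 assms(4) by (simp add: Q_def)
      have "?S \<le> 2 * q * cT * l\<^sup>2 * B" using B q0 cT0 by (intro mult_left_mono) auto
      moreover have "?L \<le> 2 * (1 + cT) * l * B" using B l1 cT0 by (intro mult_left_mono) auto
      moreover have "(1 + Q) * B \<le> l * ((1 + Q) * B)"
        using l1 Q0 B mult_right_mono[of 1 l "(1 + Q) * B"] by simp
      ultimately have "?S + D * (?L + (1 + Q) * B) \<le>
          2 * q * cT * l\<^sup>2 * B + D * (2 * (1 + cT) * l * B + l * ((1 + Q) * B))"
        by (intro add_mono mult_left_mono[OF _ D])
      also have "\<dots> = C * l\<^sup>2 * B"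
        by (simp add: C_def D_def algebra_simps power2_eq_square)
      finally show ?thesis .
    qed
    finally show "upper_expectation (hash_sample H \<kappa> t)
        (\<lambda>\<omega>. real (load (lsh_join srt scan ejoin \<delta> p \<kappa> t d r) p (join_input \<kappa> t k inp \<omega>)))
      \<le> ennreal (C * (1 + ln (real n)) ^ 2 *
          (sqrt (\<Sum>i=0..\<kappa>. real (OUT_near d r p2 \<kappa> R S i) / (real p * p1 ^ i)) +
           sqrt (real (OUT_c_near d r c R S) / real p) +
           real n / real p powr (1 / (1 + \<rho>))))"
      by (simp add: M_def l_def B_def X_def Y_def V_def \<beta>_def atLeast0AtMost ennreal_leI order_trans)
  qed
  show ?thesis
    by (intro exI[of _ K] exI[of _ C] exI[of _ "2::nat"] allI impI, elim conjE, rule main) assumption+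
qed

end
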